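(* Let $f\in C([0,1])$ be of type A, B or C, with $f(0)=f(1)=0$ and with some $k>0$ such that $|f(s)|\le ks$ and $|f(s)|\le k(1-s)$ for every $s\in[0,1]$. For every $\gamma>0$, let $c^*_\gamma$ be the critical speed for $$\gamma\left(\frac{v'}{\sqrt{1-\gamma^2(v')^2}}\right)'-c\,v'+f(v)=0,\qquad(\ast)$$ and let $v_\gamma$ be the unique heteroclinic solution of $(\ast)$ with $c=c^*_\gamma$, connecting $0$ and $1$, which satisfies $v_\gamma(0)=\mathcal{V}_0$. Then $$\lim_{\gamma\to0^+}c^*_\gamma=0,\qquad\lim_{\gamma\to0^+}v_\gamma(z)=H(z)\ \text{ for every }z\ne0,$$ where $H(z)=0$ for $z<0$ and $H(z)=1$ for $z>0$. More precisely, the convergence of $c^*_\gamma$ occurs monotonically, with order $\sqrt{\gamma}$; the convergence of $v_\gamma$ is uniform in $\mathbb{R}\setminus\mathcal{I}_0$, $\mathcal{I}_0$ being an arbitrary neighborhood of the origin.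
   Context: Types of reaction terms $f$: - type A: $f(u)>0$ for every $u\in(0,1)$; - type B: there exists $\alpha\in(0,1)$ with $f(u)=0$ for $u\in[0,\alpha]$ and $f(u)>0$ for $u\in(\alpha,1)$; - type C: there exists $\alpha\in(0,1)$ with $f<0$ on $(0,\alpha)$ and $f>0$ on $(\alpha,1)$, and moreover $\int_0^1 f(s)\,ds\ge 0$. Normalization value: $\mathcal{V}_0=1/2$ if $f$ is of type A, $\mathcal{V}_0=\alpha$ if $f$ is of type B or C. A heteroclinic solution (connecting $0$ and $1$) of $(\ast)$ is a monotone $C^2$ solution $v:\mathbb{R}\to[0,1]$ (with $\gamma|v'|<1$) such that $v(-\infty)=0$, $v(+\infty)=1$. The speeds $c\in\mathbb{R}$ for which such a solution exists (equivalently, for which the problem $y'=c\,a\,\frac{\sqrt{y(2a+y)}}{a+y}-f(v)$ with $a=1/\gamma$, $y(0)=y(1)=0$, $y>0$ on $(0,1)$, is solvable, where $y=y(v)$) form an interval $[c^*_\gamma,+\infty)$ if $f$ is of type A and a singleton $\{c^*_\gamma\}$ if $f$ is of type B or C; $c^*_\gamma$ is the critical speed, and the corresponding heteroclinic is unique up to translations in $z$. *)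

theory Defs
  imports "HOL-Analysis.Analysis" "HOL-Library.Landau_Symbols"
begin

definition type_A :: "(real \<Rightarrow> real) \<Rightarrow> bool" where
  "type_A f \<longleftrightarrow> (\<forall>u. 0 < u \<and> u < 1 \<longrightarrow> f u > 0)"

definition type_B :: "(real \<Rightarrow> real) \<Rightarrow> real \<Rightarrow> bool" where
  "type_B f \<alpha> \<longleftrightarrow> 0 < \<alpha> \<and> \<alpha> < 1 \<and>
     (\<forall>u. 0 \<le> u \<and> u \<le> \<alpha> \<longrightarrow> f u = 0) \<and>
     (\<forall>u. \<alpha> < u \<and> u < 1 \<longrightarrow> f u > 0)"

definition type_C :: "(real \<Rightarrow> real) \<Rightarrow> real \<Rightarrow> bool" where
  "type_C f \<alpha> \<longleftrightarrow> 0 < \<alpha> \<and> \<alpha> < 1 \<and>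
     (\<forall>u. 0 < u \<and> u < \<alpha> \<longrightarrow> f u < 0) \<and>
     (\<forall>u. \<alpha> < u \<and> u < 1 \<longrightarrow> f u > 0) \<and>
     integral {0..1} f \<ge> 0"

definition C2 :: "(real \<Rightarrow> real) \<Rightarrow> bool" where
  "C2 v \<longleftrightarrow> (\<forall>z. v differentiable at z) \<and> (\<forall>z. deriv v differentiable at z) \<and>
     continuous_on UNIV (deriv (deriv v))"

text \<open>A monotone solution with limits \<open>0\<close> at minus infinity and \<open>1\<close> at plus infinity is
  necessarily nondecreasing, whence \<^term>\<open>mono v\<close> below. The bound \<open>\<gamma> * \<bar>v'\<bar> < 1\<close> keeps
  the argument of the square root positive, so the flux of a \<^term>\<open>C2\<close> function is differentiable
  and the outer derivative is a genuine one.\<close>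

definition heteroclinic :: "(real \<Rightarrow> real) \<Rightarrow> real \<Rightarrow> real \<Rightarrow> (real \<Rightarrow> real) \<Rightarrow> bool" where
  "heteroclinic f \<gamma> c v \<longleftrightarrow>
     mono v \<and> (\<forall>z. 0 \<le> v z \<and> v z \<le> 1) \<and> C2 v \<and>
     (\<forall>z. \<gamma> * \<bar>deriv v z\<bar> < 1) \<and>
     (\<forall>z. \<gamma> * deriv (\<lambda>s. deriv v s / sqrt (1 - \<gamma>\<^sup>2 * (deriv v s)\<^sup>2)) z
            - c * deriv v z + f (v z) = 0) \<and>
     (v \<longlongrightarrow> 0) at_bot \<and> (v \<longlongrightarrow> 1) at_top"

definition wave_speeds :: "(real \<Rightarrow> real) \<Rightarrow> real \<Rightarrow> real set" where
  "wave_speeds f \<gamma> = {c. \<exists>v. heteroclinic f \<gamma> c v}"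

definition critical_speed :: "(real \<Rightarrow> real) \<Rightarrow> real \<Rightarrow> real" where
  "critical_speed f \<gamma> =
     (THE c. if type_A f then wave_speeds f \<gamma> = {c..} else wave_speeds f \<gamma> = {c})"

text \<open>The value at \<open>0\<close> is immaterial.\<close>

definition H :: "real \<Rightarrow> real" where
  "H z = (if z > 0 then 1 else 0)"

end

theory Submission
  imports Defs "HOL-Complex_Analysis.Great_Picard"
begin

text \<open>
  Along a monotone wave, the relativistic kinetic energy
  \<open>y = (1 / sqrt (1 - \<gamma>\<^sup>2 v'\<^sup>2) - 1) / \<gamma>\<close>, seen as a function of \<open>u = v z\<close>, solves the first order problem
  \<open>y' = c * slope \<gamma> y - f u\<close>, \<open>y 0 = y 1 = 0\<close>, \<open>y > 0\<close> on \<open>(0, 1)\<close>, where \<open>slope \<gamma>\<close> expresses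
  \<open>v'\<close> through \<open>y\<close>. Conversely every such \<^emph>\<open>profile\<close> with \<open>c \<ge> 0\<close> comes from a wave, obtained by
  solving \<open>v' = slope \<gamma> (y v)\<close>. These are \<open>has_profile\<close> and \<open>profile_imp_heteroclinic\<close>; everything
  else happens at the level of profiles.

  Since \<open>slope \<gamma>\<close> is increasing in \<open>y\<close>, profiles obey a comparison principle backward from
  \<open>u = 1\<close>. Since \<open>slope \<gamma> y / sqrt y\<close> is decreasing in \<open>y\<close>, the square roots of profiles
  obey a comparison principle forward from \<open>u = 0\<close> wherever \<open>f \<le> 0\<close>. Moreover \<open>slope \<gamma> y\<close> is
  decreasing in \<open>\<gamma>\<close>. If \<open>f \<le> 0\<close> on some \<open>[0, \<alpha>]\<close> with \<open>\<alpha> > 0\<close> (types B and C), the two principles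
  together show that \<open>\<gamma> \<le> \<gamma>'\<close> forces \<open>c \<le> c'\<close> for any two waves with parameters \<open>\<gamma>\<close>, \<open>\<gamma>'\<close>
  and speeds \<open>c\<close>, \<open>c'\<close> (\<open>profile_speed_le\<close>).
  For type A, the equation is solved backward from \<open>u = 1\<close>, and the solution is a profile as soon as
  there are supersolutions with arbitrarily small value at \<open>u = 0\<close> (\<open>profile_if_supersolutions\<close>).
  Hence the wave speeds form a closed half line that shrinks as \<open>\<gamma>\<close> grows. In all cases, for \<open>\<gamma> \<le> 1\<close>, the
  supersolution \<open>u\<^sup>2\<close> yields the bound \<open>sqrt 2 * (k + 2) * sqrt \<gamma>\<close> for the critical
  speed \<open>c\<close>, and integrating the profile equation yields
  \<open>integral {0..1} f \<le> c * sqrt (k / \<gamma>)\<close>.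

  With \<open>c = O(sqrt \<gamma>)\<close>, the profile equation stays regular as \<open>\<gamma> \<rightarrow> 0\<close>, and on each
  \<open>[\<epsilon>, 1 - \<epsilon>]\<close> the profiles are bounded below by some \<open>m > 0\<close> independent of \<open>\<gamma>\<close>
  (\<open>slow_profile_ge\<close>). There \<open>v' \<ge> slope \<gamma> m\<close>, which is of order \<open>1 / sqrt \<gamma>\<close>, so the wave crosses
  \<open>[\<epsilon>, 1 - \<epsilon>]\<close> within a time that tends to zero.
\<close>

section \<open>The velocity as a function of the kinetic energy\<close>

text \<open>The velocity \<open>v'\<close> of kinetic energy \<open>y \<ge> 0\<close>. With \<open>a = 1 / \<gamma>\<close> it is
  \<open>a * sqrt (y * (2 * a + y)) / (a + y)\<close>.\<close>

definition slope :: "real \<Rightarrow> real \<Rightarrow> real" where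
  "slope \<gamma> y = sqrt (1 - 1 / (1 + \<gamma> * y)\<^sup>2) / \<gamma>"

text \<open>The quotient \<open>slope \<gamma> y / sqrt y\<close>, written so that its monotonicity in \<open>\<gamma>\<close> and \<open>y\<close> is visible.\<close>

definition slope_factor :: "real \<Rightarrow> real \<Rightarrow> real" where
  "slope_factor \<gamma> y = sqrt ((1 / (1 + \<gamma> * y) + 1 / (1 + \<gamma> * y)\<^sup>2) / \<gamma>)"

text \<open>The kinetic energy of the velocity \<open>p\<close>, inverse to \<open>slope \<gamma>\<close> on nonnegative velocities.\<close>

definition kinetic :: "real \<Rightarrow> real \<Rightarrow> real" where
  "kinetic \<gamma> p = (1 / sqrt (1 - \<gamma>\<^sup>2 * p\<^sup>2) - 1) / \<gamma>"

lemma slope_0 [simp]: "slope \<gamma> 0 = 0"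
  by (simp add: slope_def)

lemma slope_le_inverse: "0 < \<gamma> \<Longrightarrow> slope \<gamma> y \<le> 1 / \<gamma>"
  by (simp add: slope_def divide_right_mono)

lemma slope_mono:
  assumes "0 < \<gamma>" "0 \<le> x" "x \<le> y"
  shows "slope \<gamma> x \<le> slope \<gamma> y"
proof -
  have "0 < 1 + \<gamma> * x" "1 + \<gamma> * x \<le> 1 + \<gamma> * y"
    using assms by (auto intro: add_pos_nonneg mult_left_mono)
  then have "1 / (1 + \<gamma> * y)\<^sup>2 \<le> 1 / (1 + \<gamma> * x)\<^sup>2"
    by (intro divide_left_mono power_mono mult_pos_pos zero_less_power) auto
  then show ?thesis
    using assms by (simp add: slope_def divide_right_mono)
qed

lemma slope_nonneg: "0 < \<gamma> \<Longrightarrow> 0 \<le> y \<Longrightarrow> 0 \<le> slope \<gamma> y"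
  using slope_mono[of \<gamma> 0 y] by simp

lemma slope_pos:
  assumes "0 < \<gamma>" "0 < y"
  shows "0 < slope \<gamma> y"
proof -
  have "1 < (1 + \<gamma> * y)\<^sup>2"
    using assms by (intro one_less_power) auto
  then have "0 < 1 - 1 / (1 + \<gamma> * y)\<^sup>2"
    by (simp add: divide_less_eq)
  then show ?thesis
    using assms by (simp add: slope_def del: diff_gt_0_iff_gt)
qed

lemma continuous_on_slope: "0 < \<gamma> \<Longrightarrow> continuous_on {0..} (slope \<gamma>)"
  unfolding slope_def
  by (intro continuous_intros) (auto simp: add_nonneg_eq_0_iff)

lemma slope_eq_factor:
  assumes "0 < \<gamma>" "0 \<le> y"
  shows "slope \<gamma> y = sqrt y * slope_factor \<gamma> y"
proof -
  define X where "X = 1 + \<gamma> * y"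
  have X: "X > 0" "y = (X - 1) / \<gamma>"
    using assms by (auto simp: X_def intro: add_pos_nonneg)
  have "1 - 1 / X\<^sup>2 = \<gamma>\<^sup>2 * (y * ((1 / X + 1 / X\<^sup>2) / \<gamma>))"
    unfolding X(2) using X(1) assms(1) by (simp add: divide_simps power2_eq_square) algebra
  then have "slope \<gamma> y = sqrt (\<gamma>\<^sup>2 * (y * ((1 / X + 1 / X\<^sup>2) / \<gamma>))) / \<gamma>"
    unfolding slope_def X_def[symmetric] by simp
  also have "\<dots> = sqrt y * slope_factor \<gamma> y"
    unfolding slope_factor_def X_def[symmetric] real_sqrt_mult using assms(1) by simp
  finally show ?thesis .
qed

lemma slope_factor_antimono:
  assumes "0 < \<gamma>" "\<gamma> \<le> \<gamma>'" "0 \<le> y" "y \<le> y'"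
  shows "slope_factor \<gamma>' y' \<le> slope_factor \<gamma> y"
proof -
  have 1: "0 < 1 + \<gamma> * y" "1 + \<gamma> * y \<le> 1 + \<gamma>' * y'"
    using assms by (auto intro: add_pos_nonneg mult_mono)
  then have "1 / (1 + \<gamma>' * y') \<le> 1 / (1 + \<gamma> * y)" "1 / (1 + \<gamma>' * y')\<^sup>2 \<le> 1 / (1 + \<gamma> * y)\<^sup>2"
    by (intro divide_left_mono power_mono mult_pos_pos zero_less_power; auto)+
  then show ?thesis
    unfolding slope_factor_def using 1 assms
    by (intro real_sqrt_le_mono frac_le add_mono add_nonneg_nonneg) auto
qed

lemma slope_factor_nonneg: "0 < \<gamma> \<Longrightarrow> 0 \<le> y \<Longrightarrow> 0 \<le> slope_factor \<gamma> y"
  unfolding slope_factor_def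
  by (intro real_sqrt_ge_zero divide_nonneg_nonneg add_nonneg_nonneg) auto

lemma slope_antimono:
  assumes "0 < \<gamma>" "\<gamma> \<le> \<gamma>'" "0 \<le> y"
  shows "slope \<gamma>' y \<le> slope \<gamma> y"
  using assms slope_factor_antimono[of \<gamma> \<gamma>' y y] by (simp add: slope_eq_factor mult_left_mono)

lemma slope_factor_le: "0 < \<gamma> \<Longrightarrow> 0 \<le> y \<Longrightarrow> slope_factor \<gamma> y \<le> sqrt (2 / \<gamma>)"
  using slope_factor_antimono[of \<gamma> \<gamma> 0 y] by (simp add: slope_factor_def)

lemma slope_factor_ge:
  assumes "0 < \<gamma>" "0 \<le> y"
  shows "sqrt (2 / \<gamma>) / (1 + \<gamma> * y) \<le> slope_factor \<gamma> y"
proof -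
  define X where "X = 1 + \<gamma> * y"
  have X: "X \<ge> 1"
    using assms by (auto simp: X_def)
  then have "1 / X\<^sup>2 \<le> 1 / X"
    by (intro divide_left_mono) (auto simp: power2_eq_square)
  then have "2 / X\<^sup>2 / \<gamma> \<le> (1 / X + 1 / X\<^sup>2) / \<gamma>"
    using assms by (intro divide_right_mono) auto
  then have "sqrt (2 / \<gamma> / X\<^sup>2) \<le> slope_factor \<gamma> y"
    unfolding slope_factor_def X_def[symmetric] by (simp add: mult.commute)
  moreover have "sqrt (2 / \<gamma> / X\<^sup>2) = sqrt (2 / \<gamma>) / X"
    unfolding real_sqrt_divide[of "2 / \<gamma>" "X\<^sup>2"] using X by simp
  ultimately show ?thesis
    by (simp add: X_def[symmetric])
qed

lemma slope_le:
  assumes "0 < \<gamma>" "0 \<le> y"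
  shows "slope \<gamma> y \<le> sqrt (2 / \<gamma>) * sqrt y"
  using slope_factor_le[OF assms] assms
  by (simp add: slope_eq_factor mult_left_mono mult.commute)

lemma slope_ge:
  assumes "0 < \<gamma>" "0 \<le> y"
  shows "sqrt (2 / \<gamma>) / (1 + \<gamma> * y) * sqrt y \<le> slope \<gamma> y"
  using mult_left_mono[OF slope_factor_ge[OF assms], of "sqrt y"] assms
  by (simp add: slope_eq_factor mult.commute)

lemma slope_kinetic:
  assumes "0 < \<gamma>" "0 \<le> p" "\<gamma> * p < 1"
  shows "slope \<gamma> (kinetic \<gamma> p) = p"
proof -
  have "(\<gamma> * p)\<^sup>2 < 1"
    using assms by (simp add: abs_square_less_1)
  then have "0 < 1 - \<gamma>\<^sup>2 * p\<^sup>2"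
    by (simp add: power_mult_distrib)
  then have "1 - 1 / (1 + \<gamma> * kinetic \<gamma> p)\<^sup>2 = (\<gamma> * p)\<^sup>2"
    using assms by (simp add: kinetic_def power_divide power_mult_distrib)
  then show ?thesis
    using assms by (simp add: slope_def)
qed

lemma slope_square:
  assumes "0 < \<gamma>" "0 \<le> y"
  shows "1 - \<gamma>\<^sup>2 * (slope \<gamma> y)\<^sup>2 = 1 / (1 + \<gamma> * y)\<^sup>2"
proof -
  have "1 \<le> 1 + \<gamma> * y"
    using assms by auto
  then have "1 / (1 + \<gamma> * y)\<^sup>2 \<le> 1"
    using one_le_power[of "1 + \<gamma> * y" 2] by auto
  then show ?thesis
    using assms by (simp add: slope_def power_divide)
qed

lemma DERIV_slope:
  assumes "0 < \<gamma>" "0 < y"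
  shows "(slope \<gamma> has_real_derivative 1 / (\<gamma> * (1 + \<gamma> * y) ^ 3 * slope \<gamma> y)) (at y)"
proof -
  define X where "X = 1 + \<gamma> * y"
  have X: "X > 1"
    using assms by (auto simp: X_def)
  then have X2: "1 < X\<^sup>2"
    by (intro one_less_power) auto
  have "((\<lambda>x. 1 - 1 / x\<^sup>2) has_real_derivative 2 / X ^ 3) (at X)"
    using X by (auto intro!: derivative_eq_intros simp: field_simps power2_eq_square power3_eq_cube)
  moreover have "((\<lambda>y. 1 + \<gamma> * y) has_real_derivative \<gamma>) (at y)"
    by (auto intro!: derivative_eq_intros)
  ultimately have d: "((\<lambda>y. 1 - 1 / (1 + \<gamma> * y)\<^sup>2) has_real_derivative 2 / X ^ 3 * \<gamma>) (at y)"
    unfolding X_def by (rule DERIV_chain2[where f = "\<lambda>x. 1 - 1 / x\<^sup>2"])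
  have "0 < 1 - 1 / (1 + \<gamma> * y)\<^sup>2"
    using X2 by (simp add: X_def[symmetric] divide_less_eq)
  from DERIV_chain2[OF DERIV_real_sqrt[OF this] d]
  have "((\<lambda>y. sqrt (1 - 1 / (1 + \<gamma> * y)\<^sup>2)) has_real_derivative
      inverse (sqrt (1 - 1 / X\<^sup>2)) / 2 * (2 / X ^ 3 * \<gamma>)) (at y)"
    by (simp only: X_def)
  from DERIV_cdivide[OF this, of \<gamma>] show ?thesis
    using assms X X2 by (simp add: slope_def[abs_def] X_def[symmetric] field_simps)
qed

text \<open>The derivative of the energy is \<open>\<gamma> * p\<close> times that of the flux. So along a wave the energy changes at the
  rate \<open>\<gamma> * v'\<close> times the derivative of the flux, which is \<open>v' * (c * v' - f v)\<close> by the equation.\<close>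

lemma DERIV_kinetic:
  assumes "0 < \<gamma>" "\<gamma> * \<bar>p\<bar> < 1"
  shows "(kinetic \<gamma> has_real_derivative \<gamma> * p / sqrt (1 - \<gamma>\<^sup>2 * p\<^sup>2) ^ 3) (at p)"
    and "((\<lambda>p. p / sqrt (1 - \<gamma>\<^sup>2 * p\<^sup>2)) has_real_derivative 1 / sqrt (1 - \<gamma>\<^sup>2 * p\<^sup>2) ^ 3) (at p)"
proof -
  define S where "S = sqrt (1 - \<gamma>\<^sup>2 * p\<^sup>2)"
  have "(\<gamma> * p)\<^sup>2 < 1"
    using assms by (simp add: abs_square_less_1 abs_mult)
  then have pos: "0 < 1 - \<gamma>\<^sup>2 * p\<^sup>2"
    by (simp add: power_mult_distrib)
  then have S: "S > 0" "S\<^sup>2 = 1 - \<gamma>\<^sup>2 * p\<^sup>2"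
    by (auto simp: S_def)
  have d: "((\<lambda>p. sqrt (1 - \<gamma>\<^sup>2 * p\<^sup>2)) has_real_derivative - \<gamma>\<^sup>2 * p / S) (at p)"
    using pos S unfolding S_def by (auto intro!: derivative_eq_intros simp: field_simps)
  show "(kinetic \<gamma> has_real_derivative \<gamma> * p / sqrt (1 - \<gamma>\<^sup>2 * p\<^sup>2) ^ 3) (at p)"
    unfolding kinetic_def[abs_def] S_def[symmetric]
  proof (rule DERIV_cong[OF DERIV_cdivide[OF DERIV_diff[OF DERIV_divide[OF DERIV_const d] DERIV_const]]])
    show "((0 * sqrt (1 - \<gamma>\<^sup>2 * p\<^sup>2) - 1 * (- \<gamma>\<^sup>2 * p / S)) /
        (sqrt (1 - \<gamma>\<^sup>2 * p\<^sup>2) * sqrt (1 - \<gamma>\<^sup>2 * p\<^sup>2)) - 0) / \<gamma> = \<gamma> * p / S ^ 3"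
      unfolding S_def[symmetric] using S(1) assms(1)
      by (simp add: field_simps power2_eq_square power3_eq_cube)
  qed (use pos in auto)
  have "1 * S - p * (- \<gamma>\<^sup>2 * p / S) = 1 / S"
    using S by (simp add: field_simps power2_eq_square)
  moreover have "1 / S / (S * S) = 1 / S ^ 3"
    by (simp add: power3_eq_cube)
  ultimately show "((\<lambda>p. p / sqrt (1 - \<gamma>\<^sup>2 * p\<^sup>2)) has_real_derivative
      1 / sqrt (1 - \<gamma>\<^sup>2 * p\<^sup>2) ^ 3) (at p)"
    using DERIV_divide[OF DERIV_ident d] S(1) by (simp add: S_def[symmetric])
qed

section \<open>Differential inequalities\<close>

lemma DERIV_max_zero_square:
  fixes x :: real
  shows "((\<lambda>x. (max x 0)\<^sup>2) has_real_derivative 2 * max x 0) (at x)"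
proof -
  consider "x > 0" | "x < 0" | "x = 0" by linarith
  then show ?thesis
  proof cases
    case 1
    have "((\<lambda>x. x\<^sup>2) has_real_derivative 2 * max x 0) (at x)"
      using 1 by (auto intro!: derivative_eq_intros)
    then show ?thesis
      by (rule has_field_derivative_transform_within_open[where S = "{0<..}"]) (use 1 in auto)
  next
    case 2
    have "((\<lambda>x. 0) has_real_derivative 2 * max x 0) (at x)"
      using 2 by (auto intro!: derivative_eq_intros)
    then show ?thesis
      by (rule has_field_derivative_transform_within_open[where S = "{..<0}"]) (use 2 in auto)
  next
    case 3
    have "((\<lambda>h::real. (max h 0)\<^sup>2 / h) \<longlongrightarrow> 0) (at 0)"
    proof (rule Lim_null_comparison)
      show "\<forall>\<^sub>F h in at 0. norm ((max h 0)\<^sup>2 / h) \<le> \<bar>h::real\<bar>"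
        by (rule always_eventually) (auto simp: max_def power2_eq_square)
      show "((\<lambda>h::real. \<bar>h\<bar>) \<longlongrightarrow> 0) (at 0)"
        by (rule tendsto_rabs_zero) (rule tendsto_ident_at)
    qed
    then show ?thesis
      unfolding DERIV_def using 3 by simp
  qed
qed

text \<open>The squared positive part \<open>(max D 0)\<^sup>2\<close> is differentiable and nondecreasing, and it vanishes in the
  limit at \<open>b\<close>. No Lipschitz condition is involved.\<close>

lemma comparison_backward:
  fixes D D' :: "real \<Rightarrow> real"
  assumes D: "\<And>u. a < u \<Longrightarrow> u < b \<Longrightarrow> (D has_real_derivative D' u) (at u)"
    and D': "\<And>u. a < u \<Longrightarrow> u < b \<Longrightarrow> D u > 0 \<Longrightarrow> D' u \<ge> 0"
    and lim: "(D \<longlongrightarrow> l) (at_left b)" "l \<le> 0"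
    and u: "a < u" "u < b"
  shows "D u \<le> 0"
proof -
  define q where "q = (\<lambda>u. (max (D u) 0)\<^sup>2)"
  have q': "(q has_real_derivative 2 * max (D s) 0 * D' s) (at s)" if "a < s" "s < b" for s
    unfolding q_def by (rule DERIV_chain2[OF DERIV_max_zero_square D[OF that]])
  have q_le: "q u \<le> q s" if "u \<le> s" "s < b" for s
  proof (rule DERIV_nonneg_imp_nondecreasing[OF that(1)])
    fix x assume x: "u \<le> x" "x \<le> s"
    then have "0 \<le> 2 * max (D x) 0 * D' x"
      using D'[of x] u that by (cases "D x > 0") auto
    then show "\<exists>y. (q has_real_derivative y) (at x) \<and> 0 \<le> y"
      using q'[of x] x u that by auto
  qed
  have "(q \<longlongrightarrow> (max l 0)\<^sup>2) (at_left b)"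
    unfolding q_def by (intro tendsto_intros lim)
  moreover have "\<forall>\<^sub>F s in at_left b. q u \<le> q s"
    using eventually_at_left_real[OF u(2)] by eventually_elim (use q_le in auto)
  ultimately have "q u \<le> (max l 0)\<^sup>2"
    by (rule tendsto_lowerbound) auto
  then show ?thesis
    using lim(2) by (auto simp: q_def max_def split: if_splits)
qed

lemma comparison_forward:
  fixes D D' :: "real \<Rightarrow> real"
  assumes D: "\<And>u. a < u \<Longrightarrow> u < b \<Longrightarrow> (D has_real_derivative D' u) (at u)"
    and D': "\<And>u. a < u \<Longrightarrow> u < b \<Longrightarrow> D u > 0 \<Longrightarrow> D' u \<le> 0"
    and lim: "(D \<longlongrightarrow> l) (at_right a)" "l \<le> 0"
    and u: "a < u" "u < b"
  shows "D u \<le> 0"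
proof -
  have "D (- (- u)) \<le> 0"
  proof (rule comparison_backward[where D = "\<lambda>u. D (- u)" and u = "- u" and a = "- b" and b = "- a" and D' = "\<lambda>u. - D' (- u)" and l = l])
    show "((\<lambda>u. D (- u)) has_real_derivative - D' (- u)) (at u)" if "- b < u" "u < - a" for u
      using DERIV_chain2[OF D[of "- u"] DERIV_minus[OF DERIV_ident]] that by auto
    show "- D' (- u) \<ge> 0" if "- b < u" "u < - a" "D (- u) > 0" for u
      using D'[of "- u"] that by auto
    show "((\<lambda>u. D (- u)) \<longlongrightarrow> l) (at_left (- a))"
      using lim(1) by (simp add: filterlim_at_left_to_right)
  qed (use lim u in auto)
  then show ?thesis by simp
qed

section \<open>Existence for scalar differential equations\<close>

text \<open>Tonelli's delayed approximations to the solution of \<open>y' = h t y\<close>, \<open>y 0 = y0\<close> on \<open>[0, 1]\<close>: the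
  field is evaluated at the previous iterate, delayed by \<open>\<delta>\<close>. The delay is truncated at time \<open>0\<close>, where every
  iterate equals \<open>y0\<close>.\<close>

primrec tonelli :: "(real \<Rightarrow> real \<Rightarrow> real) \<Rightarrow> real \<Rightarrow> real \<Rightarrow> nat \<Rightarrow> real \<Rightarrow> real" where
  "tonelli h y0 \<delta> 0 = (\<lambda>t. y0)"
| "tonelli h y0 \<delta> (Suc j) =
     (\<lambda>t. y0 + integral {0..t} (\<lambda>s. h s (tonelli h y0 \<delta> j (max 0 (s - \<delta>)))))"

lemma integral_Lipschitz:
  fixes g :: "real \<Rightarrow> real"
  assumes g: "continuous_on {0..1} g" and M: "\<And>t. t \<in> {0..1} \<Longrightarrow> \<bar>g t\<bar> \<le> M"
    and st: "s \<in> {0..1}" "t \<in> {0..1}"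
  shows "\<bar>integral {0..t} g - integral {0..s} g\<bar> \<le> M * \<bar>t - s\<bar>"
proof -
  have *: "\<bar>integral {0..t} g - integral {0..s} g\<bar> \<le> M * (t - s)" if "0 \<le> s" "s \<le> t" "t \<le> 1" for s t
  proof -
    have c: "continuous_on {s..t} g" "continuous_on {0..t} g"
      using that by (auto intro: continuous_on_subset[OF g])
    have "integral {0..t} g - integral {0..s} g = integral {s..t} g"
      using Henstock_Kurzweil_Integration.integral_combine[of 0 s t g] that integrable_continuous_interval[OF c(2)] by simp
    moreover have "norm (integral {s..t} g) \<le> M * (t - s)"
      by (rule integral_bound) (use that c M in auto)
    ultimately show ?thesis by simp
  qed
  show ?thesis
    using *[of s t] *[of t s] st by (cases "s \<le> t") (auto simp: abs_minus_commute)
qed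

context
  fixes h :: "real \<Rightarrow> real \<Rightarrow> real" and M y0 :: real
  assumes h: "continuous_on ({0..1} \<times> UNIV) (\<lambda>(t, y). h t y)"
    and M: "\<And>t y. t \<in> {0..1} \<Longrightarrow> \<bar>h t y\<bar> \<le> M"
begin

lemma continuous_on_field:
  assumes "continuous_on {0..1} g"
  shows "continuous_on {0..1} (\<lambda>s. h s (g s))"
  using continuous_on_compose2[OF h continuous_on_Pair[OF continuous_on_id assms]] by auto

lemma tonelli_Lipschitz:
  assumes "\<delta> \<ge> 0" "s \<in> {0..1}" "t \<in> {0..1}"
  shows "\<bar>tonelli h y0 \<delta> j t - tonelli h y0 \<delta> j s\<bar> \<le> M * \<bar>t - s\<bar>"
    and "continuous_on {0..1} (\<lambda>s. h s (tonelli h y0 \<delta> j (max 0 (s - \<delta>))))"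
proof -
  have M0: "M \<ge> 0"
    using M[of 0 0] by auto
  have c: "continuous_on {0..1} g"
    if "\<And>s t. s \<in> {0..1} \<Longrightarrow> t \<in> {0..1} \<Longrightarrow> \<bar>g t - g s\<bar> \<le> M * \<bar>t - s\<bar>" for g :: "real \<Rightarrow> real"
    using that M0
    by (intro Lipschitz.lipschitz_on_continuous_on[of M] lipschitz_onI) (auto simp: dist_real_def)
  have cf: "continuous_on {0..1} (\<lambda>s. h s (g (max 0 (s - \<delta>))))" if "continuous_on {0..1} g" for g
    by (intro continuous_on_field continuous_on_compose2[OF that])
      (use assms(1) in \<open>auto intro!: continuous_intros\<close>)
  have "\<forall>s \<in> {0..1}. \<forall>t \<in> {0..1}. \<bar>tonelli h y0 \<delta> j t - tonelli h y0 \<delta> j s\<bar> \<le> M * \<bar>t - s\<bar>"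
  proof (induction j)
    case 0
    then show ?case using M0 by simp
  next
    case (Suc j)
    have "continuous_on {0..1} (\<lambda>s. h s (tonelli h y0 \<delta> j (max 0 (s - \<delta>))))"
      by (rule cf, rule c) (use Suc in blast)
    from integral_Lipschitz[OF this, of M] show ?case
      using M by simp
  qed
  then show "\<bar>tonelli h y0 \<delta> j t - tonelli h y0 \<delta> j s\<bar> \<le> M * \<bar>t - s\<bar>"
    and "continuous_on {0..1} (\<lambda>s. h s (tonelli h y0 \<delta> j (max 0 (s - \<delta>))))"
    using assms cf[OF c] by auto
qed

text \<open>The \<open>j\<close>-th iterate is final on \<open>[0, j * \<delta>]\<close>, so for \<open>\<delta> = 1 / n\<close> the \<open>n\<close>-th iterate solves the
  delayed equation on all of \<open>[0, 1]\<close>.\<close>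

lemma tonelli_stable:
  assumes "\<delta> \<ge> 0" "0 \<le> t" "t \<le> real j * \<delta>"
  shows "tonelli h y0 \<delta> (Suc j) t = tonelli h y0 \<delta> j t"
  using assms(2,3)
proof (induction j arbitrary: t)
  case 0
  then have "t = 0" by simp
  then show ?case by simp
next
  case (Suc j)
  have "h s (tonelli h y0 \<delta> (Suc j) (max 0 (s - \<delta>))) = h s (tonelli h y0 \<delta> j (max 0 (s - \<delta>)))"
    if "s \<in> {0..t}" for s
  proof -
    have "max 0 (s - \<delta>) \<le> real j * \<delta>"
      using that Suc.prems assms(1) by (auto simp: algebra_simps)
    then show ?thesis
      using Suc.IH[of "max 0 (s - \<delta>)"] by simp
  qed
  then have "integral {0..t} (\<lambda>s. h s (tonelli h y0 \<delta> (Suc j) (max 0 (s - \<delta>)))) =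
      integral {0..t} (\<lambda>s. h s (tonelli h y0 \<delta> j (max 0 (s - \<delta>))))"
    by (rule integral_cong)
  then show ?case by simp
qed

text \<open>Peano's theorem on \<open>[0, 1]\<close> for a bounded field, by compactness of the delayed solutions.\<close>

theorem peano:
  "\<exists>Y. Y 0 = y0 \<and> (\<forall>t\<in>{0..1}. (Y has_real_derivative h t (Y t)) (at t within {0..1}))"
proof -
  have M0: "M \<ge> 0"
    using M[of 0 0] by auto
  define \<delta> where "\<delta> = (\<lambda>n. 1 / real (Suc n))"
  define U where "U = (\<lambda>n. tonelli h y0 (\<delta> n) (Suc n))"
  have \<delta>0: "\<delta> n \<ge> 0" for n
    by (simp add: \<delta>_def)
  have Lip: "\<bar>U n t - U n s\<bar> \<le> M * \<bar>t - s\<bar>" if "s \<in> {0..1}" "t \<in> {0..1}" for n s t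
    unfolding U_def by (rule tonelli_Lipschitz(1)[OF \<delta>0 that])
  have U_eq: "U n t = y0 + integral {0..t} (\<lambda>s. h s (U n (max 0 (s - \<delta> n))))"
    if "t \<in> {0..1}" for n t
  proof -
    have "real (Suc n) * \<delta> n = 1"
      by (simp add: \<delta>_def)
    then have "U n t = tonelli h y0 (\<delta> n) (Suc (Suc n)) t"
      using tonelli_stable[OF \<delta>0, of t "Suc n" n] that by (simp add: U_def del: tonelli.simps)
    then show ?thesis
      by (simp add: U_def del: tonelli.simps(2)) (simp only: tonelli.simps)
  qed
  have U0: "U n 0 = y0" for n
    by (simp add: U_eq)
  have "norm (U n t) \<le> \<bar>y0\<bar> + M" if "t \<in> {0..1}" for n t
    using Lip[of 0 t n] that U0[of n] mult_left_mono[of t 1 M] M0 by (auto simp: abs_le_iff)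
  moreover have "\<exists>d>0. \<forall>n s. s \<in> {0..1} \<and> norm (t - s) < d \<longrightarrow> norm (U n t - U n s) < e"
    if "t \<in> {0..1}" "e > 0" for t e
  proof (intro exI[of _ "e / (M + 1)"] conjI allI impI)
    show "0 < e / (M + 1)"
      using that M0 by simp
    fix n s assume s: "s \<in> {0..1} \<and> norm (t - s) < e / (M + 1)"
    then have "norm (U n t - U n s) \<le> M * norm (t - s)"
      using Lip[of s t n] that by simp
    also have "\<dots> \<le> (M + 1) * norm (t - s)"
      by (intro mult_right_mono) auto
    also have "\<dots> < e"
      using s M0 by (simp add: field_simps)
    finally show "norm (U n t - U n s) < e" .
  qed
  ultimately obtain Y r where Y: "continuous_on {0..1} Y" "strict_mono (r :: nat \<Rightarrow> nat)"
    "\<And>e. 0 < e \<Longrightarrow> \<exists>N. \<forall>n x. n \<ge> N \<and> x \<in> {0..1} \<longrightarrow> norm (U (r n) x - Y x) < e"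
    using Arzela_Ascoli[of "{0..1}" U "\<bar>y0\<bar> + M"] by (metis compact_Icc)
  have lim: "(\<lambda>n. U (r n) t) \<longlonglongrightarrow> Y t" if "t \<in> {0..1}" for t
    unfolding LIMSEQ_iff using Y(3) that by blast
  have "\<delta> \<longlonglongrightarrow> 0"
    unfolding \<delta>_def using LIMSEQ_inverse_real_of_nat by (simp add: inverse_eq_divide)
  then have \<delta>_lim: "(\<lambda>n. \<delta> (r n)) \<longlonglongrightarrow> 0"
    using LIMSEQ_subseq_LIMSEQ[OF _ Y(2)] by (auto simp: o_def)
  have lim_delay: "(\<lambda>n. U (r n) (max 0 (s - \<delta> (r n)))) \<longlonglongrightarrow> Y s" if s: "s \<in> {0..1}" for s
  proof -
    have "(\<lambda>n. U (r n) (max 0 (s - \<delta> (r n))) - U (r n) s) \<longlonglongrightarrow> 0"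
    proof (rule Lim_null_comparison)
      show "\<forall>\<^sub>F n in sequentially. norm (U (r n) (max 0 (s - \<delta> (r n))) - U (r n) s) \<le> M * \<delta> (r n)"
      proof (rule always_eventually, rule allI)
        fix n
        have "\<bar>U (r n) (max 0 (s - \<delta> (r n))) - U (r n) s\<bar> \<le> M * \<bar>max 0 (s - \<delta> (r n)) - s\<bar>"
          by (rule Lip) (use s \<delta>0[of "r n"] in auto)
        also have "\<dots> \<le> M * \<delta> (r n)"
          using s \<delta>0[of "r n"] M0 by (intro mult_left_mono) auto
        finally show "norm (U (r n) (max 0 (s - \<delta> (r n))) - U (r n) s) \<le> M * \<delta> (r n)" by simp
      qed
      show "(\<lambda>n. M * \<delta> (r n)) \<longlonglongrightarrow> 0"
        using tendsto_mult_right_zero[OF \<delta>_lim] .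
    qed
    from tendsto_add[OF this lim[OF s]] show ?thesis by simp
  qed
  have Y_eq: "Y t = y0 + integral {0..t} (\<lambda>s. h s (Y s))" if t: "t \<in> {0..1}" for t
  proof -
    have "(\<lambda>n. integral {0..t} (\<lambda>s. h s (U (r n) (max 0 (s - \<delta> (r n)))))) \<longlonglongrightarrow>
        integral {0..t} (\<lambda>s. h s (Y s))"
    proof (rule dominated_convergence(2)[where h = "\<lambda>_. M"])
      show "(\<lambda>s. h s (U (r n) (max 0 (s - \<delta> (r n))))) integrable_on {0..t}" for n
        unfolding U_def using t
        by (intro integrable_continuous_interval continuous_on_subset[OF tonelli_Lipschitz(2)[OF \<delta>0]]) auto
      show "(\<lambda>n. h s (U (r n) (max 0 (s - \<delta> (r n))))) \<longlonglongrightarrow> h s (Y s)" if "s \<in> {0..t}" for s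
      proof -
        have "range (Pair s) \<subseteq> {0..1} \<times> UNIV"
          using that t by auto
        then have "continuous_on UNIV (\<lambda>y. h s y)"
          using continuous_on_compose2[OF h continuous_on_Pair[OF continuous_on_const[of UNIV s] continuous_on_id]]
          by auto
        then have "isCont (\<lambda>y. h s y) (Y s)"
          by (simp add: continuous_on_eq_continuous_at)
        from isCont_tendsto_compose[OF this lim_delay] show ?thesis
          using that t by auto
      qed
    qed (use M t in auto)
    from tendsto_add[OF tendsto_const[of y0] this]
    have "(\<lambda>n. U (r n) t) \<longlonglongrightarrow> y0 + integral {0..t} (\<lambda>s. h s (Y s))"
      by (simp add: U_eq[OF t, symmetric])
    with lim[OF t] show ?thesis
      by (rule LIMSEQ_unique)
  qed
  show ?thesis
  proof (intro exI[of _ Y] conjI ballI)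
    show "Y 0 = y0"
      by (simp add: Y_eq)
    fix t :: real assume t: "t \<in> {0..1}"
    have "((\<lambda>t. integral {0..t} (\<lambda>s. h s (Y s))) has_real_derivative h t (Y t)) (at t within {0..1})"
      by (rule integral_has_real_derivative[OF continuous_on_field[OF Y(1)] t])
    from DERIV_add[OF DERIV_const[of y0] this]
    have "((\<lambda>t. y0 + integral {0..t} (\<lambda>s. h s (Y s))) has_real_derivative h t (Y t)) (at t within {0..1})"
      by simp
    then show "(Y has_real_derivative h t (Y t)) (at t within {0..1})"
      by (rule has_field_derivative_transform_within[OF _ zero_less_one t]) (simp add: Y_eq)
  qed
qed

end

section \<open>Reaction terms and profiles\<close>

text \<open>Solutions of the first order boundary value problem for the kinetic energy as a function of the state.
  Only the values on the open interval matter; the boundary conditions are one-sided limits.\<close>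

definition profile :: "(real \<Rightarrow> real) \<Rightarrow> real \<Rightarrow> real \<Rightarrow> (real \<Rightarrow> real) \<Rightarrow> bool" where
  "profile f \<gamma> c y \<longleftrightarrow>
     (\<forall>u. 0 < u \<and> u < 1 \<longrightarrow>
        y u > 0 \<and> (y has_real_derivative c * slope \<gamma> (y u) - f u) (at u)) \<and>
     (y \<longlongrightarrow> 0) (at_right 0) \<and> (y \<longlongrightarrow> 0) (at_left 1)"

lemma profile_pos: "profile f \<gamma> c y \<Longrightarrow> 0 < u \<Longrightarrow> u < 1 \<Longrightarrow> y u > 0"
  and DERIV_profile: "profile f \<gamma> c y \<Longrightarrow> 0 < u \<Longrightarrow> u < 1 \<Longrightarrow>
    (y has_real_derivative c * slope \<gamma> (y u) - f u) (at u)"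
  and profile_at_0: "profile f \<gamma> c y \<Longrightarrow> (y \<longlongrightarrow> 0) (at_right 0)"
  and profile_at_1: "profile f \<gamma> c y \<Longrightarrow> (y \<longlongrightarrow> 0) (at_left 1)"
  by (auto simp: profile_def)

text \<open>The three types of reaction terms at once: \<open>\<alpha> = 0\<close> is type A, where the condition on \<open>[0, \<alpha>]\<close> only
  says \<open>f 0 \<le> 0\<close>. Type B and type C have \<open>\<alpha> > 0\<close>.\<close>

locale reaction =
  fixes f :: "real \<Rightarrow> real" and k \<alpha> :: real
  assumes cont: "continuous_on {0..1} f"
    and k_pos: "k > 0"
    and bound_0: "\<And>s. s \<in> {0..1} \<Longrightarrow> \<bar>f s\<bar> \<le> k * s"
    and bound_1: "\<And>s. s \<in> {0..1} \<Longrightarrow> \<bar>f s\<bar> \<le> k * (1 - s)"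
    and alpha: "0 \<le> \<alpha>" "\<alpha> < 1"
    and nonpos: "\<And>u. 0 \<le> u \<Longrightarrow> u \<le> \<alpha> \<Longrightarrow> f u \<le> 0"
    and pos: "\<And>u. \<alpha> < u \<Longrightarrow> u < 1 \<Longrightarrow> f u > 0"
    and mass: "integral {0..1} f \<ge> 0"
begin

lemma bound: "s \<in> {0..1} \<Longrightarrow> \<bar>f s\<bar> \<le> k"
  using order_trans[OF bound_0[of s], of k] mult_left_mono[of s 1 k] k_pos by simp

text \<open>The extension of \<open>f\<close> to a continuous function on the line, constant outside \<open>[0, 1]\<close>. Its primitive
  is differentiable at every value of a wave, including \<open>0\<close> and \<open>1\<close>.\<close>

definition extension :: "real \<Rightarrow> real" where
  "extension u = f (max 0 (min 1 u))"

lemma extension_eq: "0 \<le> u \<Longrightarrow> u \<le> 1 \<Longrightarrow> extension u = f u"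
  by (simp add: extension_def)

lemma continuous_extension: "continuous_on S extension"
  unfolding extension_def[abs_def]
  by (rule continuous_on_compose2[OF cont]) (auto intro!: continuous_intros)

definition primitive :: "real \<Rightarrow> real" where
  "primitive = (SOME F. \<forall>u. (F has_real_derivative extension u) (at u))"

lemma DERIV_primitive: "(primitive has_real_derivative extension u) (at u)"
proof -
  have "\<exists>F. \<forall>u. (F has_real_derivative extension u) (at u)"
    using einterval_antiderivative[of "-\<infinity>" "\<infinity>" extension]
      continuous_on_eq_continuous_at[OF open_UNIV, THEN iffD1, OF continuous_extension]
    by (auto simp: has_real_derivative_iff_has_vector_derivative)
  then show ?thesis
    unfolding primitive_def by (drule_tac someI_ex) blast
qed

lemma primitive_mass: "primitive 1 - primitive 0 = integral {0..1} f"
proof -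
  have "(extension has_integral (primitive 1 - primitive 0)) {0..1}"
    by (rule fundamental_theorem_of_calculus)
      (auto intro!: has_field_derivative_at_within DERIV_primitive
        simp flip: has_real_derivative_iff_has_vector_derivative)
  then have "(f has_integral (primitive 1 - primitive 0)) {0..1}"
    by (rule has_integral_eq_rhs[OF has_integral_eq, rotated]) (auto simp: extension_eq)
  then show ?thesis by (simp add: integral_unique)
qed

end

section \<open>The profile of a travelling wave\<close>

text \<open>A velocity \<open>p\<close> whose derivative is bounded by \<open>K\<close> cannot stop before time \<open>p / K\<close>, during which \<open>v\<close> gains
  \<open>p\<^sup>2 / (2 * K)\<close>.\<close>

lemma deriv_square_le:
  fixes v p q :: "real \<Rightarrow> real"
  assumes v: "\<And>z. (v has_real_derivative p z) (at z)"
    and p: "\<And>z. (p has_real_derivative q z) (at z)"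
    and K: "K > 0" "\<And>z. \<bar>q z\<bar> \<le> K"
    and "p z \<ge> 0" "\<And>z. v z \<le> 1"
  shows "(p z)\<^sup>2 \<le> 2 * K * (1 - v z)"
proof -
  have mono: "p z + K * z \<le> p s + K * s" if "z \<le> s" for s
  proof (rule DERIV_nonneg_imp_nondecreasing[OF that, where f = "\<lambda>s. p s + K * s"])
    fix x
    have "((\<lambda>s. p s + K * s) has_real_derivative q x + K) (at x)"
      by (auto intro!: derivative_eq_intros p)
    moreover have "q x + K \<ge> 0"
      using K(2)[of x] by linarith
    ultimately show "\<exists>y. ((\<lambda>s. p s + K * s) has_real_derivative y) (at x) \<and> 0 \<le> y"
      by blast
  qed
  define h where "h = (\<lambda>s. v s - p z * (s - z) + K / 2 * (s - z)\<^sup>2)"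
  define t where "t = z + p z / K"
  have "z \<le> t"
    using assms by (simp add: t_def)
  then have "h z \<le> h t"
  proof (rule DERIV_nonneg_imp_nondecreasing)
    fix x assume x: "z \<le> x" "x \<le> t"
    have "(h has_real_derivative p x - p z + K * (x - z)) (at x)"
      unfolding h_def by (auto intro!: derivative_eq_intros v)
    moreover have "p x - p z + K * (x - z) \<ge> 0"
      using mono[OF x(1)] by (simp add: algebra_simps)
    ultimately show "\<exists>y. (h has_real_derivative y) (at x) \<and> 0 \<le> y"
      by blast
  qed
  then have "v z \<le> v t - p z * (p z / K) + K / 2 * (p z / K)\<^sup>2"
    by (simp add: h_def t_def)
  also have "\<dots> = v t - (p z)\<^sup>2 / (2 * K)"
    using K(1) by (simp add: field_simps power2_eq_square)
  finally have "(p z)\<^sup>2 / (2 * K) \<le> 1 - v z"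
    using \<open>v t \<le> 1\<close> by linarith
  then show ?thesis
    using K(1) by (simp add: field_simps)
qed

locale wave = reaction +
  fixes \<gamma> c :: real and v :: "real \<Rightarrow> real"
  assumes gamma: "\<gamma> > 0" and het: "heteroclinic f \<gamma> c v"
begin

lemma v_mono: "mono v" and v_ge_0: "0 \<le> v z" and v_le_1: "v z \<le> 1"
  and v_at_bot: "(v \<longlongrightarrow> 0) at_bot" and v_at_top: "(v \<longlongrightarrow> 1) at_top"
  using het by (auto simp: heteroclinic_def)

lemma DERIV_v: "(v has_real_derivative deriv v z) (at z)"
  and DERIV_deriv_v: "(deriv v has_real_derivative deriv (deriv v) z) (at z)"
  using het by (auto simp: heteroclinic_def C2_def DERIV_deriv_iff_real_differentiable)

lemma deriv_v_nonneg: "0 \<le> deriv v z"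
  using mono_on_imp_deriv_nonneg[of UNIV v "deriv v z" z] v_mono DERIV_v[of z] by auto

lemma gamma_deriv_v: "\<gamma> * \<bar>deriv v z\<bar> < 1"
  using het by (auto simp: heteroclinic_def)

lemma lorentz_pos: "0 < 1 - \<gamma>\<^sup>2 * (deriv v z)\<^sup>2"
proof -
  have "(\<gamma> * deriv v z)\<^sup>2 < 1"
    using gamma_deriv_v[of z] gamma by (simp add: abs_square_less_1 abs_mult)
  then show ?thesis
    by (simp add: power_mult_distrib)
qed

lemma equation: "\<gamma> * deriv (deriv v) z / sqrt (1 - \<gamma>\<^sup>2 * (deriv v z)\<^sup>2) ^ 3 = c * deriv v z - f (v z)"
proof -
  have "((\<lambda>s. deriv v s / sqrt (1 - \<gamma>\<^sup>2 * (deriv v s)\<^sup>2)) has_real_derivative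
      1 / sqrt (1 - \<gamma>\<^sup>2 * (deriv v z)\<^sup>2) ^ 3 * deriv (deriv v) z) (at z)"
    by (rule DERIV_chain2[OF DERIV_kinetic(2)[OF gamma gamma_deriv_v] DERIV_deriv_v])
  from DERIV_imp_deriv[OF this]
  have "deriv (\<lambda>s. deriv v s / sqrt (1 - \<gamma>\<^sup>2 * (deriv v s)\<^sup>2)) z =
      1 / sqrt (1 - \<gamma>\<^sup>2 * (deriv v z)\<^sup>2) ^ 3 * deriv (deriv v) z" .
  moreover have "\<gamma> * deriv (\<lambda>s. deriv v s / sqrt (1 - \<gamma>\<^sup>2 * (deriv v s)\<^sup>2)) z
            - c * deriv v z + f (v z) = 0"
    using het by (auto simp: heteroclinic_def)
  ultimately show ?thesis by simp
qed

text \<open>The kinetic energy at time \<open>z\<close>.\<close>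

definition energy :: "real \<Rightarrow> real" where
  "energy z = kinetic \<gamma> (deriv v z)"

lemma DERIV_energy: "(energy has_real_derivative deriv v z * (c * deriv v z - f (v z))) (at z)"
proof -
  have "(energy has_real_derivative
      \<gamma> * deriv v z / sqrt (1 - \<gamma>\<^sup>2 * (deriv v z)\<^sup>2) ^ 3 * deriv (deriv v) z) (at z)"
    unfolding energy_def[abs_def]
    by (rule DERIV_chain2[OF DERIV_kinetic(1)[OF gamma gamma_deriv_v] DERIV_deriv_v])
  then show ?thesis
    unfolding equation[symmetric] by (simp add: ac_simps)
qed

lemma slope_energy: "slope \<gamma> (energy z) = deriv v z"
  unfolding energy_def using slope_kinetic gamma deriv_v_nonneg gamma_deriv_v[of z] by simp

lemma energy_nonneg: "0 \<le> energy z"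
  unfolding energy_def kinetic_def using gamma lorentz_pos[of z]
  by (intro divide_nonneg_pos) auto

text \<open>A bound for the acceleration \<open>v''\<close> of the wave.\<close>

definition K :: real where "K = (\<bar>c\<bar> / \<gamma> + k) / \<gamma>"

lemma K_pos: "K > 0"
  unfolding K_def using gamma k_pos by (intro divide_pos_pos add_nonneg_pos) auto

lemma deriv2_bound: "\<bar>deriv (deriv v) z\<bar> \<le> K"
proof -
  define S where "S = sqrt (1 - \<gamma>\<^sup>2 * (deriv v z)\<^sup>2) ^ 3"
  have S: "0 < S" "S \<le> 1"
    using lorentz_pos[of z] by (auto simp: S_def intro!: power_le_one)
  have "\<bar>deriv v z\<bar> \<le> 1 / \<gamma>"
    using gamma_deriv_v[of z] gamma by (simp add: field_simps)
  then have "\<bar>c * deriv v z\<bar> \<le> \<bar>c\<bar> / \<gamma>"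
    using mult_left_mono[of "\<bar>deriv v z\<bar>" "1 / \<gamma>" "\<bar>c\<bar>"] by (simp add: abs_mult)
  moreover have "\<bar>f (v z)\<bar> \<le> k"
    using bound v_ge_0 v_le_1 by simp
  ultimately have "\<bar>c * deriv v z - f (v z)\<bar> \<le> \<bar>c\<bar> / \<gamma> + k"
    by linarith
  then have *: "\<bar>c * deriv v z - f (v z)\<bar> * S \<le> (\<bar>c\<bar> / \<gamma> + k) * 1"
    using S by (intro mult_mono) auto
  have "deriv (deriv v) z = (c * deriv v z - f (v z)) * S / \<gamma>"
    using equation[of z] S(1) gamma unfolding S_def[symmetric] by (simp add: field_simps)
  then show ?thesis
    using * S(1) gamma by (simp add: K_def abs_mult divide_right_mono)
qed

lemma deriv_v_square_le: "(deriv v z)\<^sup>2 \<le> 2 * K * (1 - v z)" "(deriv v z)\<^sup>2 \<le> 2 * K * v z"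
proof -
  show "(deriv v z)\<^sup>2 \<le> 2 * K * (1 - v z)"
    by (rule deriv_square_le[OF DERIV_v DERIV_deriv_v K_pos deriv2_bound deriv_v_nonneg v_le_1])
  have d: "((\<lambda>s. 1 - v (- s)) has_real_derivative deriv v (- s)) (at s)"
       "((\<lambda>s. deriv v (- s)) has_real_derivative - deriv (deriv v) (- s)) (at s)" for s
    using DERIV_chain2[OF DERIV_v[of "- s"] DERIV_minus[OF DERIV_ident]]
      DERIV_chain2[OF DERIV_deriv_v[of "- s"] DERIV_minus[OF DERIV_ident]]
    by (auto intro!: derivative_eq_intros)
  have "(deriv v (- (- z)))\<^sup>2 \<le> 2 * K * (1 - (1 - v (- (- z))))"
    by (rule deriv_square_le[OF d, of K "- z"]) (auto simp: K_pos deriv2_bound deriv_v_nonneg v_ge_0)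
  then show "(deriv v z)\<^sup>2 \<le> 2 * K * v z"
    by simp
qed

lemma deriv_v_le: "deriv v z \<le> sqrt (2 * K * (1 - v z))" "deriv v z \<le> sqrt (2 * K * v z)"
  using deriv_v_square_le[of z] by (auto intro: real_le_rsqrt)

lemma energy_tendsto_0:
  assumes "((\<lambda>x. deriv v (h x)) \<longlongrightarrow> 0) F"
  shows "((\<lambda>x. energy (h x)) \<longlongrightarrow> 0) F"
proof -
  have "isCont (kinetic \<gamma>) 0"
    using DERIV_isCont[OF DERIV_kinetic(1)[OF gamma, of 0]] by simp
  from isCont_tendsto_compose[OF this assms] show ?thesis
    by (simp add: energy_def kinetic_def)
qed

lemma deriv_v_tendsto_0:
  assumes "((\<lambda>x. v (h x)) \<longlongrightarrow> 0) F \<or> ((\<lambda>x. v (h x)) \<longlongrightarrow> 1) F"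
  shows "((\<lambda>x. deriv v (h x)) \<longlongrightarrow> 0) F"
  using assms
proof
  assume *: "((\<lambda>x. v (h x)) \<longlongrightarrow> 0) F"
  have "((\<lambda>x. sqrt (2 * K * v (h x))) \<longlongrightarrow> sqrt (2 * K * 0)) F"
    by (intro tendsto_intros *)
  then show ?thesis
    by (intro tendsto_sandwich[of "\<lambda>_. 0" "\<lambda>x. deriv v (h x)" F "\<lambda>x. sqrt (2 * K * v (h x))"])
      (auto simp: deriv_v_nonneg deriv_v_le)
next
  assume *: "((\<lambda>x. v (h x)) \<longlongrightarrow> 1) F"
  have "((\<lambda>x. sqrt (2 * K * (1 - v (h x)))) \<longlongrightarrow> sqrt (2 * K * (1 - 1))) F"
    by (intro tendsto_intros *)
  then show ?thesis
    by (intro tendsto_sandwich[of "\<lambda>_. 0" "\<lambda>x. deriv v (h x)" F "\<lambda>x. sqrt (2 * K * (1 - v (h x)))"])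
      (auto simp: deriv_v_nonneg deriv_v_le)
qed

text \<open>The energy plus the primitive of \<open>f\<close> has derivative \<open>c * v'\<^sup>2\<close> along the wave and increases
  by the integral of \<open>f\<close> in total.\<close>

lemma speed_nonneg: "0 \<le> c"
proof (rule ccontr)
  assume "\<not> 0 \<le> c"
  then have c: "c < 0" by simp
  define G where "G = (\<lambda>z. energy z + primitive (v z))"
  have G': "(G has_real_derivative c * (deriv v z)\<^sup>2) (at z)" for z
  proof -
    have "((\<lambda>z. primitive (v z)) has_real_derivative f (v z) * deriv v z) (at z)"
      using DERIV_chain2[OF DERIV_primitive DERIV_v] by (simp add: extension_eq v_ge_0 v_le_1)
    from DERIV_add[OF DERIV_energy this] show ?thesis
      by (simp add: G_def algebra_simps power2_eq_square)
  qed
  have antimono: "G t \<le> G s" if "s \<le> t" for s t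
    using that
  proof (rule DERIV_nonpos_imp_nonincreasing)
    show "\<exists>y. (G has_real_derivative y) (at x) \<and> y \<le> 0" for x
      using G'[of x] c by (auto simp: mult_nonpos_nonneg)
  qed
  have P: "isCont primitive u" for u
    using DERIV_isCont[OF DERIV_primitive] .
  have "(G \<longlongrightarrow> 0 + primitive 0) at_bot" "(G \<longlongrightarrow> 0 + primitive 1) at_top"
    unfolding G_def
    by (intro tendsto_add energy_tendsto_0 deriv_v_tendsto_0 isCont_tendsto_compose[OF P]
        v_at_bot v_at_top disjI1 disjI2)+
  then have lim: "(G \<longlongrightarrow> primitive 0) at_bot" "(G \<longlongrightarrow> primitive 1) at_top"
    by simp_all
  have "G z = primitive 0" for z
  proof (rule antisym)
    show "G z \<le> primitive 0"
      by (rule tendsto_lowerbound[OF lim(1)])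
        (auto intro: eventually_mono[OF eventually_le_at_bot[of z]] antimono)
    have "primitive 1 \<le> G z"
      by (rule tendsto_upperbound[OF lim(2)])
        (auto intro: eventually_mono[OF eventually_ge_at_top[of z]] antimono)
    then show "primitive 0 \<le> G z"
      using mass primitive_mass by simp
  qed
  then have "G = (\<lambda>_. primitive 0)" by auto
  with G' have "c * (deriv v z)\<^sup>2 = 0" for z
    by (metis DERIV_const DERIV_unique)
  then have "deriv v z = 0" for z
    using c by simp
  then have "v z = v 0" for z
    using DERIV_isconst_all[of v] DERIV_v by metis
  then have "(v \<longlongrightarrow> v 0) at_bot" "(v \<longlongrightarrow> v 0) at_top"
    by (auto intro!: tendsto_eventually always_eventually)
  then have "v 0 = 0" "v 0 = 1"
    using tendsto_unique[OF _ _ v_at_bot] tendsto_unique[OF _ _ v_at_top] by auto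
  then show False by simp
qed

text \<open>A wave never rests at a value in \<open>(0, 1)\<close>. Where \<open>f > 0\<close> the minimum \<open>v' = 0\<close> contradicts the equation.
  Where \<open>f \<le> 0\<close> the energy is nondecreasing up to \<open>z\<close>, so the wave would have been at rest forever.\<close>

lemma deriv_v_pos:
  assumes "0 < v z" "v z < 1"
  shows "0 < deriv v z"
proof (rule ccontr)
  assume "\<not> 0 < deriv v z"
  then have p0: "deriv v z = 0"
    using deriv_v_nonneg[of z] by simp
  show False
  proof (cases "v z \<le> \<alpha>")
    case False
    have "deriv (deriv v) z = 0"
      by (rule DERIV_local_min[OF DERIV_deriv_v zero_less_one]) (simp add: p0 deriv_v_nonneg)
    then have "f (v z) = 0"
      using equation[of z] p0 by simp
    then show False
      using pos[of "v z"] False assms by simp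
  next
    case True
    have "energy s \<le> energy z" if "s \<le> z" for s
      using that
    proof (rule DERIV_nonneg_imp_nondecreasing)
      fix x assume "s \<le> x" "x \<le> z"
      then have "v x \<le> \<alpha>"
        using True v_mono by (meson monoD order_trans)
      then have "0 \<le> deriv v x * (c * deriv v x - f (v x))"
        using nonpos[of "v x"] v_ge_0 deriv_v_nonneg[of x] speed_nonneg
        by (intro mult_nonneg_nonneg) (auto intro: order_trans[of _ 0])
      then show "\<exists>y. (energy has_real_derivative y) (at x) \<and> 0 \<le> y"
        using DERIV_energy by blast
    qed
    then have "energy s = 0" if "s \<le> z" for s
      using that energy_nonneg[of s] p0 by (force simp: energy_def kinetic_def)
    then have "deriv v s = 0" if "s \<le> z" for s
      using that slope_energy[of s] by simp
    then have "v z \<le> v s" if "s \<le> z" for s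
      using that DERIV_v
      by (intro DERIV_nonpos_imp_nonincreasing[OF that]) (metis order_refl)
    then have "v z \<le> 0"
      by (intro tendsto_lowerbound[OF v_at_bot])
        (auto intro: eventually_mono[OF eventually_le_at_bot[of z]])
    then show False
      using assms by simp
  qed
qed

lemma v_inj:
  assumes "0 < v s" "v s < 1" "v s = v t"
  shows "s = t"
proof -
  have *: "\<not> s < t" if st: "0 < v s" "v s < 1" "v s = v t" for s t
  proof
    assume "s < t"
    obtain d where "d > 0" "\<And>h. 0 < h \<Longrightarrow> h < d \<Longrightarrow> v s < v (s + h)"
      using DERIV_pos_inc_right[OF DERIV_v deriv_v_pos[OF st(1,2)]] by auto
    then have "v s < v (s + min (d / 2) (t - s))"
      using \<open>s < t\<close> by auto
    also have "\<dots> \<le> v t"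
      by (rule monoD[OF v_mono]) simp
    finally show False using st by simp
  qed
  show ?thesis
    using *[of s t] *[of t s] assms by (metis linorder_neqE)
qed

lemma v_surj:
  assumes "0 < u" "u < 1"
  shows "\<exists>z. v z = u"
proof -
  obtain a where a: "v a < u"
    using order_tendstoD(2)[OF v_at_bot assms(1)] by (auto simp: eventually_at_bot_linorder)
  obtain b where b: "u < v b"
    using order_tendstoD(1)[OF v_at_top assms(2)] by (auto simp: eventually_at_top_linorder)
  have "a \<le> b"
    using a b v_mono by (meson linear monoD not_less order_trans)
  then show ?thesis
    using IVT'[of v a u b] a b continuous_at_imp_continuous_on[of "{a..b}" v] DERIV_isCont[OF DERIV_v]
    by auto
qed

theorem has_profile:
  "\<exists>y. profile f \<gamma> c y \<and> (\<forall>z. 0 < v z \<and> v z < 1 \<longrightarrow> deriv v z = slope \<gamma> (y (v z)))"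
proof -
  \<comment> \<open>The inverse of \<open>v\<close> on \<open>(0, 1)\<close>; composed with it, the energy becomes a function of the state.\<close>
  define w where "w = (\<lambda>u. SOME z. v z = u)"
  have vw: "v (w u) = u" if "0 < u" "u < 1" for u
    unfolding w_def using v_surj[OF that] by (rule someI_ex)
  have wv: "w (v z) = z" if "0 < v z" "v z < 1" for z
    using v_inj[of z "w (v z)"] vw[OF that] that by simp
  have w': "(w has_real_derivative inverse (deriv v (w u))) (at u)" if u: "0 < u" "u < 1" for u
  proof (rule DERIV_inverse_function[where f = v and a = 0 and b = 1])
    show "(v has_real_derivative deriv v (w u)) (at (w u))"
      by (rule DERIV_v)
    show "deriv v (w u) \<noteq> 0"
      using deriv_v_pos[of "w u"] vw u by simp
    have "(v \<longlongrightarrow> v (w u)) (nhds (w u))"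
      using DERIV_isCont[OF DERIV_v, of "w u"] by (simp add: isCont_def tendsto_at_iff_tendsto_nhds)
    then have "(v \<longlongrightarrow> u) (nhds (w u))"
      using vw[OF u] by simp
    from eventually_conj[OF order_tendstoD(1)[OF this u(1)] order_tendstoD(2)[OF this u(2)]]
    have "\<forall>\<^sub>F z in nhds (w u). 0 < v z \<and> v z < 1" .
    then obtain d where d: "d > 0" "\<And>z. dist z (w u) < d \<Longrightarrow> 0 < v z \<and> v z < 1"
      by (auto simp: eventually_nhds_metric)
    have "isCont w (v (w u))"
    proof (rule isCont_inverse_function[where f = v and g = w and x = "w u" and d = "d / 2"])
      show "w (v z) = z" if "\<bar>z - w u\<bar> \<le> d / 2" for z
        using d(2)[of z] that d(1) wv by (auto simp: dist_real_def)
      show "isCont v z" for z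
        by (rule DERIV_isCont[OF DERIV_v])
    qed (use d in auto)
    then show "isCont w u"
      using vw[OF u] by simp
  qed (use u vw in auto)
  define y where "y = (\<lambda>u. energy (w u))"
  have slope_y: "slope \<gamma> (y u) = deriv v (w u)" for u
    by (simp add: y_def slope_energy)
  have "y u > 0 \<and> (y has_real_derivative c * slope \<gamma> (y u) - f u) (at u)"
    if u: "0 < u" "u < 1" for u
  proof
    have p: "deriv v (w u) > 0"
      using deriv_v_pos[of "w u"] vw u by simp
    then show "y u > 0"
      using energy_nonneg[of "w u"] slope_y[of u] by (cases "y u = 0") (auto simp: y_def)
    show "(y has_real_derivative c * slope \<gamma> (y u) - f u) (at u)"
      unfolding slope_y unfolding y_def
      by (rule DERIV_cong[OF DERIV_chain2[OF DERIV_energy[of "w u"] w'[OF u]]])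
        (use p vw[OF u] in simp)
  qed
  moreover have "(y \<longlongrightarrow> 0) (at_right 0)"
  proof -
    have "\<forall>\<^sub>F u in at_right 0. u = v (w u)"
      using eventually_at_right_real[OF zero_less_one] by eventually_elim (simp add: vw)
    then have "((\<lambda>u. v (w u)) \<longlongrightarrow> 0) (at_right 0)"
      by (rule Lim_transform_eventually[OF tendsto_ident_at])
    then show ?thesis
      unfolding y_def by (intro energy_tendsto_0 deriv_v_tendsto_0 disjI1)
  qed
  moreover have "(y \<longlongrightarrow> 0) (at_left 1)"
  proof -
    have "\<forall>\<^sub>F u in at_left 1. u = v (w u)"
      using eventually_at_left_real[OF zero_less_one] by eventually_elim (simp add: vw)
    then have "((\<lambda>u. v (w u)) \<longlongrightarrow> 1) (at_left 1)"
      by (rule Lim_transform_eventually[OF tendsto_ident_at])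
    then show ?thesis
      unfolding y_def by (intro energy_tendsto_0 deriv_v_tendsto_0 disjI2)
  qed
  ultimately have "profile f \<gamma> c y"
    unfolding profile_def by blast
  moreover have "deriv v z = slope \<gamma> (y (v z))" if "0 < v z" "v z < 1" for z
    using slope_y[of "v z"] wv[OF that] by simp
  ultimately show ?thesis by blast
qed

end

section \<open>The travelling wave of a profile\<close>

context reaction
begin

text \<open>The quadratic bounds of a profile at both ends, at \<open>1\<close> here and at \<open>0\<close> in \<open>sqrt_profile_le_left\<close>,
  keep the wave from reaching \<open>0\<close> or \<open>1\<close> in finite time.\<close>

lemma profile_le_right:
  assumes "\<gamma> > 0" "c \<ge> 0" and y: "profile f \<gamma> c y" and u: "0 < u" "u < 1"
  shows "y u \<le> k / 2 * (1 - u)\<^sup>2"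
proof -
  have "y u - k / 2 * (1 - u)\<^sup>2 \<le> 0"
  proof (rule comparison_backward[where D = "\<lambda>u. y u - k / 2 * (1 - u)\<^sup>2" and u = u and a = 0 and b = 1 and l = "0 - k / 2 * (1 - 1)\<^sup>2"
        and D' = "\<lambda>u. c * slope \<gamma> (y u) - f u + k * (1 - u)"])
    show "((\<lambda>u. y u - k / 2 * (1 - u)\<^sup>2) has_real_derivative
        c * slope \<gamma> (y u) - f u + k * (1 - u)) (at u)" if "0 < u" "u < 1" for u
      by (auto intro!: derivative_eq_intros DERIV_profile[OF y] that simp: field_simps)
    show "0 \<le> c * slope \<gamma> (y u) - f u + k * (1 - u)" if "0 < u" "u < 1" for u
    proof -
      have "0 \<le> c * slope \<gamma> (y u)"
        using assms slope_nonneg profile_pos[OF y that] by simp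
      then show ?thesis
        using bound_1[of u] that by auto
    qed
    show "((\<lambda>u. y u - k / 2 * (1 - u)\<^sup>2) \<longlongrightarrow> 0 - k / 2 * (1 - 1)\<^sup>2) (at_left 1)"
      by (intro tendsto_intros profile_at_1[OF y])
  qed (use u in auto)
  then show ?thesis by simp
qed

lemma DERIV_sqrt_profile:
  assumes "profile f \<gamma> c y" "0 < u" "u < 1"
  shows "((\<lambda>u. sqrt (y u)) has_real_derivative (c * slope \<gamma> (y u) - f u) / (2 * sqrt (y u))) (at u)"
  using DERIV_chain2[OF DERIV_real_sqrt[OF profile_pos[OF assms]] DERIV_profile[OF assms]]
  by (rule DERIV_cong) (simp add: field_simps)

lemma sqrt_profile_le_left:
  assumes "\<gamma> > 0" "c \<ge> 0" and y: "profile f \<gamma> c y" and u: "0 < u" "u < 1"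
  shows "sqrt (y u) \<le> (c * sqrt (2 / \<gamma>) + k + 1) * u"
proof -
  \<comment> \<open>This \<open>B\<close> dominates \<open>c * sqrt (2 / \<gamma>) + k\<close>, and \<open>B \<ge> 1\<close>: above \<open>B * u\<close> one
      has \<open>- f u \<le> k * u \<le> k * sqrt (y u)\<close>.\<close>
  define B where "B = c * sqrt (2 / \<gamma>) + k + 1"
  have B: "B \<ge> 1" "0 \<le> c * sqrt (2 / \<gamma>)"
    using assms k_pos by (auto simp: B_def)
  have "sqrt (y u) - B * u \<le> 0"
  proof (rule comparison_forward[where D = "\<lambda>u. sqrt (y u) - B * u" and u = u and a = 0 and b = 1 and l = "sqrt 0 - B * 0"
        and D' = "\<lambda>u. (c * slope \<gamma> (y u) - f u) / (2 * sqrt (y u)) - B"])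
    show "((\<lambda>u. sqrt (y u) - B * u) has_real_derivative
        (c * slope \<gamma> (y u) - f u) / (2 * sqrt (y u)) - B) (at u)" if "0 < u" "u < 1" for u
      using DERIV_diff[OF DERIV_sqrt_profile[OF y that] DERIV_cmult_Id[of B]] by simp
    show "(c * slope \<gamma> (y u) - f u) / (2 * sqrt (y u)) - B \<le> 0"
      if u: "0 < u" "u < 1" and D: "sqrt (y u) - B * u > 0" for u
    proof -
      have ypos: "y u > 0"
        by (rule profile_pos[OF y u])
      have "c * slope \<gamma> (y u) \<le> c * (sqrt (2 / \<gamma>) * sqrt (y u))"
        using assms ypos by (intro mult_left_mono slope_le) auto
      moreover have "- f u \<le> k * sqrt (y u)"
      proof -
        have "1 * u \<le> B * u"
          using B u by (intro mult_right_mono) auto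
        then have "k * u \<le> k * sqrt (y u)"
          using D k_pos by simp
        then show ?thesis
          using bound_0[of u] u by auto
      qed
      ultimately have "c * slope \<gamma> (y u) - f u \<le> (c * sqrt (2 / \<gamma>) + k) * sqrt (y u)"
        by (simp add: algebra_simps)
      also have "\<dots> \<le> B * (2 * sqrt (y u))"
      proof -
        have "0 \<le> B * sqrt (y u)" "(c * sqrt (2 / \<gamma>) + k) * sqrt (y u) \<le> B * sqrt (y u)"
          using B(1) ypos by (auto intro!: mult_right_mono simp: B_def)
        then show ?thesis by simp
      qed
      finally show ?thesis
        using ypos by (simp add: divide_le_eq)
    qed
    show "((\<lambda>u. sqrt (y u) - B * u) \<longlongrightarrow> sqrt 0 - B * 0) (at_right 0)"
      by (intro tendsto_intros profile_at_0[OF y])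
  qed (use u in auto)
  then show ?thesis by (simp add: B_def)
qed

lemma DERIV_slope_profile:
  assumes "\<gamma> > 0" "profile f \<gamma> c y" "0 < u" "u < 1"
  shows "((\<lambda>u. slope \<gamma> (y u)) has_real_derivative
    1 / (\<gamma> * (1 + \<gamma> * y u) ^ 3 * slope \<gamma> (y u)) * (c * slope \<gamma> (y u) - f u)) (at u)"
  by (rule DERIV_chain2[OF DERIV_slope[OF assms(1) profile_pos[OF assms(2-4)]]
        DERIV_profile[OF assms(2-4)]])

lemma slope_profile_le:
  assumes "\<gamma> > 0" "c \<ge> 0" "profile f \<gamma> c y"
  shows "\<exists>L>0. \<forall>u. 0 < u \<and> u < 1 \<longrightarrow> slope \<gamma> (y u) \<le> L * u \<and> slope \<gamma> (y u) \<le> L * (1 - u)"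
proof -
  define L1 where "L1 = sqrt (2 / \<gamma>) * (c * sqrt (2 / \<gamma>) + k + 1)"
  define L2 where "L2 = sqrt (2 / \<gamma>) * sqrt (k / 2)"
  have L: "L1 > 0" "L2 \<ge> 0"
    using assms k_pos by (auto simp: L1_def L2_def intro!: mult_pos_pos add_nonneg_pos)
  have "slope \<gamma> (y u) \<le> (L1 + L2) * u \<and> slope \<gamma> (y u) \<le> (L1 + L2) * (1 - u)" if u: "0 < u" "u < 1" for u
  proof
  have ypos: "y u > 0"
    by (rule profile_pos[OF assms(3) u])
  have le: "slope \<gamma> (y u) \<le> sqrt (2 / \<gamma>) * sqrt (y u)"
    using slope_le assms ypos by simp
  also have "\<dots> \<le> sqrt (2 / \<gamma>) * ((c * sqrt (2 / \<gamma>) + k + 1) * u)"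
    using assms by (intro mult_left_mono sqrt_profile_le_left u) auto
  also have "\<dots> \<le> (L1 + L2) * u"
    using L u by (simp add: L1_def[symmetric] mult.assoc[symmetric] mult_right_mono)
  finally show "slope \<gamma> (y u) \<le> (L1 + L2) * u" .
  have "sqrt (y u) \<le> sqrt (k / 2 * (1 - u)\<^sup>2)"
    by (rule real_sqrt_le_mono[OF profile_le_right[OF assms u]])
  also have "\<dots> = sqrt (k / 2) * (1 - u)"
    unfolding real_sqrt_mult using u by simp
  finally have "sqrt (2 / \<gamma>) * sqrt (y u) \<le> L2 * (1 - u)"
    using mult_left_mono[of "sqrt (y u)" "sqrt (k / 2) * (1 - u)" "sqrt (2 / \<gamma>)"] assms
    by (simp add: L2_def)
  moreover have "L2 * (1 - u) \<le> (L1 + L2) * (1 - u)"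
    using L u by (intro mult_right_mono) auto
  ultimately show "slope \<gamma> (y u) \<le> (L1 + L2) * (1 - u)"
    using le by linarith
  qed
  then show ?thesis
    using L by (intro exI[of _ "L1 + L2"]) auto
qed

end

text \<open>The solution inverts a primitive \<open>T\<close> of \<open>1 / G\<close>; by the linear bounds on \<open>G\<close>, \<open>T\<close> diverges
  at least logarithmically at both ends and so maps \<open>(0, 1)\<close> onto the line.\<close>

lemma autonomous_solution:
  fixes G :: "real \<Rightarrow> real"
  assumes G: "\<And>u. 0 < u \<Longrightarrow> u < 1 \<Longrightarrow> isCont G u" "\<And>u. 0 < u \<Longrightarrow> u < 1 \<Longrightarrow> G u > 0"
    and L: "L > 0" "\<And>u. 0 < u \<Longrightarrow> u < 1 \<Longrightarrow> G u \<le> L * u"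
    "\<And>u. 0 < u \<Longrightarrow> u < 1 \<Longrightarrow> G u \<le> L * (1 - u)"
  shows "\<exists>v. (\<forall>z. (v has_real_derivative G (v z)) (at z)) \<and> (\<forall>z. 0 < v z) \<and> (\<forall>z. v z < 1) \<and>
    (v \<longlongrightarrow> 0) at_bot \<and> (v \<longlongrightarrow> 1) at_top"
proof -
  have "\<exists>F. \<forall>x. ereal 0 < x \<longrightarrow> x < ereal 1 \<longrightarrow> (F has_vector_derivative 1 / G x) (at x)"
    using G by (intro einterval_antiderivative) (auto intro!: continuous_intros less_imp_neq[THEN not_sym])
  then obtain T where T: "\<And>u. 0 < u \<Longrightarrow> u < 1 \<Longrightarrow> (T has_real_derivative 1 / G u) (at u)"
    by (auto simp: has_real_derivative_iff_has_vector_derivative)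
  have T_less: "T s < T t" if "0 < s" "s < t" "t < 1" for s t
  proof (rule DERIV_pos_imp_increasing[OF that(2)])
    fix x assume "s \<le> x" "x \<le> t"
    then show "\<exists>y. (T has_real_derivative y) (at x) \<and> 0 < y"
      using T[of x] G(2)[of x] that by (intro exI[of _ "1 / G x"]) auto
  qed
  have T_left: "T u - ln u / L \<le> T (1 / 2) - ln (1 / 2) / L" if "0 < u" "u \<le> 1 / 2" for u
  proof (rule DERIV_nonneg_imp_nondecreasing[OF that(2)])
    fix x assume x: "u \<le> x" "x \<le> 1 / 2"
    have "((\<lambda>u. T u - ln u / L) has_real_derivative 1 / G x - 1 / x / L) (at x)"
      using x that by (intro derivative_intros T DERIV_cdivide DERIV_ln_divide) auto
    moreover have "1 / (x * L) \<le> 1 / G x"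
      using x that G(2)[of x] L(2)[of x] by (intro divide_left_mono) (auto simp: mult.commute L)
    ultimately show "\<exists>y. ((\<lambda>u. T u - ln u / L) has_real_derivative y) (at x) \<and> 0 \<le> y"
      by force
  qed
  have T_right: "T (1 / 2) + ln (1 - 1 / 2) / L \<le> T u + ln (1 - u) / L" if "1 / 2 \<le> u" "u < 1" for u
  proof (rule DERIV_nonneg_imp_nondecreasing[OF that(1)])
    fix x assume x: "1 / 2 \<le> x" "x \<le> u"
    have "((\<lambda>u. T u + ln (1 - u) / L) has_real_derivative 1 / G x + (1 / (1 - x) * (0 - 1)) / L) (at x)"
      using x that
      by (intro DERIV_add DERIV_cdivide DERIV_chain2[OF DERIV_ln_divide] T DERIV_diff DERIV_const DERIV_ident) auto
    moreover have "1 / ((1 - x) * L) \<le> 1 / G x"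
      using x that G(2)[of x] L(3)[of x] by (intro divide_left_mono) (auto simp: mult.commute L)
    ultimately show "\<exists>y. ((\<lambda>u. T u + ln (1 - u) / L) has_real_derivative y) (at x) \<and> 0 \<le> y"
      by force
  qed
  have surj: "\<exists>u. 0 < u \<and> u < 1 \<and> T u = z" for z
  proof -
    \<comment> \<open>Chosen so that the logarithmic bounds put \<open>z\<close> between \<open>T a\<close> and \<open>T (1 - a)\<close>.\<close>
    define m where "m = L * (\<bar>z - T (1 / 2)\<bar> + 1)"
    define a where "a = exp (- m) / 2"
    have m: "m > 0" "m / L = \<bar>z - T (1 / 2)\<bar> + 1"
      using L(1) by (auto simp: m_def intro!: mult_pos_pos)
    have a: "0 < a" "a < 1 / 2"
      using m by (auto simp: a_def)
    have ln_a: "ln a = ln (1 / 2) - m"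
      unfolding a_def by (simp add: ln_div)
    have "T a \<le> T (1 / 2) - m / L"
      using T_left[of a] a by (simp add: ln_a diff_divide_distrib)
    then have 1: "T a < z"
      unfolding m(2) by linarith
    have "T (1 / 2) + m / L \<le> T (1 - a)"
      using T_right[of "1 - a"] a by (simp add: ln_a diff_divide_distrib)
    then have 2: "z < T (1 - a)"
      unfolding m(2) by linarith
    have "continuous_on {a..1 - a} T"
      using a by (intro continuous_at_imp_continuous_on ballI DERIV_isCont[OF T]) auto
    then obtain u where "a \<le> u" "u \<le> 1 - a" "T u = z"
      using IVT'[of T a z "1 - a"] 1 2 a by auto
    then show ?thesis
      using a by (intro exI[of _ u]) auto
  qed
  define v where "v = (\<lambda>z. SOME u. 0 < u \<and> u < 1 \<and> T u = z)"
  have v: "0 < v z \<and> v z < 1 \<and> T (v z) = z" for z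
    unfolding v_def using surj[of z] by (rule someI_ex)
  have vT: "v (T u) = u" if "0 < u" "u < 1" for u
    using v[of "T u"] T_less[of u "v (T u)"] T_less[of "v (T u)" u] that
    by (metis less_irrefl linorder_neqE)
  have v_less: "v s < v t" if "s < t" for s t
    using v[of s] v[of t] T_less[of "v t" "v s"] that
    by (metis less_irrefl linorder_neqE order_less_trans)
  show ?thesis
  proof (intro exI[of _ v] conjI allI)
    show "0 < v z" "v z < 1" for z
      using v[of z] by simp_all
    show "(v has_real_derivative G (v z)) (at z)" for z
    proof -
      define d where "d = min (v z) (1 - v z) / 2"
      have d: "d > 0" "d < v z" "d < 1 - v z"
        using v[of z] by (auto simp: d_def min_def)
      have "isCont v (T (v z))"
      proof (rule isCont_inverse_function[where f = T and g = v and x = "v z" and d = d])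
        show "v (T s) = s" if "\<bar>s - v z\<bar> \<le> d" for s
          using that d by (intro vT) auto
        show "isCont T s" if "\<bar>s - v z\<bar> \<le> d" for s
          using that d by (intro DERIV_isCont[OF T]) auto
      qed (rule d)
      then have "(v has_real_derivative inverse (1 / G (v z))) (at z)"
        using v G(2)[of "v z"]
        by (intro DERIV_inverse_function[where f = T and a = "z - 1" and b = "z + 1"] T) auto
      then show ?thesis by simp
    qed
    show "(v \<longlongrightarrow> 0) at_bot"
    proof (rule order_tendstoI)
      fix e :: real assume "0 < e"
      then have "v z < e" if "z \<le> T (min e (1 / 2)) - 1" for z
        using v_less[of z "T (min e (1 / 2))"] vT[of "min e (1 / 2)"] that by auto
      then show "\<forall>\<^sub>F z in at_bot. v z < e"
        by (auto simp: eventually_at_bot_linorder)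
    next
      fix e :: real assume "e < 0"
      then show "\<forall>\<^sub>F z in at_bot. e < v z"
        using v by (intro always_eventually) (meson order_less_trans)
    qed
    show "(v \<longlongrightarrow> 1) at_top"
    proof (rule order_tendstoI)
      fix e :: real assume "e < 1"
      then have "e < v z" if "z \<ge> T (max e (1 / 2)) + 1" for z
        using v_less[of "T (max e (1 / 2))" z] vT[of "max e (1 / 2)"] that by auto
      then show "\<forall>\<^sub>F z in at_top. e < v z"
        by (auto simp: eventually_at_top_linorder)
    next
      fix e :: real assume "1 < e"
      then show "\<forall>\<^sub>F z in at_top. v z < e"
        using v by (intro always_eventually) (meson order_less_trans)
    qed
  qed
qed

context reaction
begin

theorem profile_imp_heteroclinic:
  assumes "\<gamma> > 0" "c \<ge> 0" and y: "profile f \<gamma> c y"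
  shows "\<exists>v. heteroclinic f \<gamma> c v"
proof -
  define G where "G = (\<lambda>u. slope \<gamma> (y u))"
  have G_pos: "G u > 0" if "0 < u" "u < 1" for u
    using slope_pos[OF assms(1) profile_pos[OF y that]] by (simp add: G_def)
  obtain L where L: "L > 0" "\<And>u. 0 < u \<Longrightarrow> u < 1 \<Longrightarrow> G u \<le> L * u"
    "\<And>u. 0 < u \<Longrightarrow> u < 1 \<Longrightarrow> G u \<le> L * (1 - u)"
    using slope_profile_le[OF assms] by (auto simp: G_def)
  have G_cont: "isCont G u" if "0 < u" "u < 1" for u
    unfolding G_def by (rule DERIV_isCont[OF DERIV_slope_profile[OF assms(1) y that]])
  obtain v where v: "\<And>z. (v has_real_derivative G (v z)) (at z)" "\<And>z. 0 < v z \<and> v z < 1"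
    "(v \<longlongrightarrow> 0) at_bot" "(v \<longlongrightarrow> 1) at_top"
    using autonomous_solution[OF G_cont G_pos L] by auto
  have v_Icc: "0 \<le> v z" "v z \<le> 1" for z
    using v(2)[of z] by auto
  have deriv_v: "deriv v = (\<lambda>z. G (v z))"
    using DERIV_imp_deriv[OF v(1)] by auto
  define X where "X = (\<lambda>z. 1 + \<gamma> * y (v z))"
  have X: "X z > 1" for z
    using assms(1) profile_pos[OF y] v(2) by (simp add: X_def)
  have deriv2: "((\<lambda>z. G (v z)) has_real_derivative (c * G (v z) - f (v z)) / (\<gamma> * X z ^ 3)) (at z)" for z
  proof (rule DERIV_cong)
    show "((\<lambda>z. G (v z)) has_real_derivative
        1 / (\<gamma> * (1 + \<gamma> * y (v z)) ^ 3 * slope \<gamma> (y (v z))) * (c * slope \<gamma> (y (v z)) - f (v z)) *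
        G (v z)) (at z)"
      unfolding G_def
      by (rule DERIV_chain2[OF DERIV_slope_profile[OF assms(1) y] v(1)[unfolded G_def]]) (use v(2) in auto)
    show "1 / (\<gamma> * (1 + \<gamma> * y (v z)) ^ 3 * slope \<gamma> (y (v z))) * (c * slope \<gamma> (y (v z)) - f (v z)) *
        G (v z) = (c * G (v z) - f (v z)) / (\<gamma> * X z ^ 3)"
      using G_pos[of "v z"] v(2)[of z] by (simp add: X_def G_def)
  qed
  have deriv_deriv_v: "deriv (deriv v) = (\<lambda>z. (c * G (v z) - f (v z)) / (\<gamma> * X z ^ 3))"
    unfolding deriv_v using DERIV_imp_deriv[OF deriv2] by auto
  have lorentz: "1 - \<gamma>\<^sup>2 * (G (v z))\<^sup>2 = 1 / (X z)\<^sup>2" for z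
    using slope_square[OF assms(1), of "y (v z)"] profile_pos[OF y, of "v z"] v(2)[of z]
    by (simp add: G_def X_def)
  have G_less: "\<gamma> * \<bar>G (v z)\<bar> < 1" for z
  proof -
    have "0 < 1 / (X z)\<^sup>2"
      using X[of z] by simp
    then have "(\<gamma> * G (v z))\<^sup>2 < 1"
      unfolding power_mult_distrib using lorentz[of z] by linarith
    then show ?thesis
      using assms(1) by (simp add: abs_square_less_1 abs_mult)
  qed
  have cont_v: "continuous_on UNIV v"
    using DERIV_isCont[OF v(1)] by (simp add: continuous_on_eq_continuous_at)
  have cont_f: "continuous_on UNIV (\<lambda>z. f (v z))"
    by (rule continuous_on_compose2[OF cont cont_v]) (use v_Icc in auto)
  have "continuous_on {0<..<1} y"
    by (rule continuous_at_imp_continuous_on) (auto intro: DERIV_isCont[OF DERIV_profile[OF y]])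
  then have cont_y: "continuous_on UNIV (\<lambda>z. y (v z))"
    by (rule continuous_on_compose2[OF _ cont_v]) (use v(2) in auto)
  have cont_G: "continuous_on UNIV (\<lambda>z. G (v z))"
    using DERIV_isCont[OF deriv2] by (simp add: continuous_on_eq_continuous_at)
  have "C2 v"
    unfolding C2_def
  proof (intro conjI allI)
    show "v differentiable at z" for z
      using v(1) real_differentiable_def by blast
    show "deriv v differentiable at z" for z
      unfolding deriv_v using deriv2 real_differentiable_def by blast
    show "continuous_on UNIV (deriv (deriv v))"
      unfolding deriv_deriv_v using X assms(1)
      by (intro continuous_intros cont_f cont_G)
        (auto simp: X_def intro!: continuous_intros cont_y less_imp_neq[THEN not_sym] order_less_trans[OF zero_less_one])
  qed
  moreover have "mono v"
    by (rule monoI, rule DERIV_nonneg_imp_nondecreasing, assumption)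
      (use v(1,2) G_pos in \<open>metis less_imp_le\<close>)
  moreover have "\<gamma> * deriv (\<lambda>s. deriv v s / sqrt (1 - \<gamma>\<^sup>2 * (deriv v s)\<^sup>2)) z
            - c * deriv v z + f (v z) = 0" for z
  proof -
    have "((\<lambda>s. G (v s) / sqrt (1 - \<gamma>\<^sup>2 * (G (v s))\<^sup>2)) has_real_derivative
        1 / sqrt (1 - \<gamma>\<^sup>2 * (G (v z))\<^sup>2) ^ 3 * ((c * G (v z) - f (v z)) / (\<gamma> * X z ^ 3))) (at z)"
      by (rule DERIV_chain2[OF DERIV_kinetic(2)[OF assms(1) G_less] deriv2])
    moreover have "sqrt (1 - \<gamma>\<^sup>2 * (G (v z))\<^sup>2) = 1 / X z"
      unfolding lorentz real_sqrt_divide using X[of z] by simp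
    ultimately have "((\<lambda>s. G (v s) / sqrt (1 - \<gamma>\<^sup>2 * (G (v s))\<^sup>2)) has_real_derivative
        (c * G (v z) - f (v z)) / \<gamma>) (at z)"
      using X[of z] by (simp add: power_divide)
    from DERIV_imp_deriv[OF this] show ?thesis
      unfolding deriv_v using assms(1) by simp
  qed
  ultimately have "heteroclinic f \<gamma> c v"
    unfolding heteroclinic_def using v v_Icc G_less by (auto simp: deriv_v)
  then show ?thesis by blast
qed

end

section \<open>Supersolutions and the set of wave speeds\<close>

context reaction
begin

text \<open>Nonnegative functions that bound the solutions vanishing at \<open>1\<close> from above; nothing is required at \<open>0\<close>.\<close>

definition supersolution :: "real \<Rightarrow> real \<Rightarrow> (real \<Rightarrow> real) \<Rightarrow> bool" where
  "supersolution \<gamma> c w \<longleftrightarrow>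
     (\<forall>u. 0 < u \<and> u < 1 \<longrightarrow> 0 \<le> w u \<and>
       (\<exists>w'. (w has_real_derivative w') (at u) \<and> w' \<le> c * slope \<gamma> (w u) - f u)) \<and>
     (\<exists>l\<ge>0. (w \<longlongrightarrow> l) (at_left 1))"

lemma le_supersolution:
  assumes "\<gamma> > 0" "c \<ge> 0" and w: "supersolution \<gamma> c w"
    and y: "\<And>u. 0 < u \<Longrightarrow> u < 1 \<Longrightarrow> (y has_real_derivative c * slope \<gamma> (y u) - f u) (at u)"
      "(y \<longlongrightarrow> 0) (at_left 1)"
    and u: "0 < u" "u < 1"
  shows "y u \<le> w u"
proof -
  obtain w' where w': "\<And>u. 0 < u \<Longrightarrow> u < 1 \<Longrightarrow> (w has_real_derivative w' u) (at u)"
    "\<And>u. 0 < u \<Longrightarrow> u < 1 \<Longrightarrow> w' u \<le> c * slope \<gamma> (w u) - f u"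
    using w unfolding supersolution_def by metis
  obtain l where l: "l \<ge> 0" "(w \<longlongrightarrow> l) (at_left 1)"
    using w unfolding supersolution_def by blast
  have "y u - w u \<le> 0"
  proof (rule comparison_backward[where D = "\<lambda>u. y u - w u" and u = u and a = 0 and b = 1
        and l = "0 - l" and D' = "\<lambda>u. c * slope \<gamma> (y u) - f u - w' u"])
    show "((\<lambda>u. y u - w u) has_real_derivative c * slope \<gamma> (y u) - f u - w' u) (at u)"
      if "0 < u" "u < 1" for u
      by (intro DERIV_diff[OF y(1) w'(1)] that)
    show "c * slope \<gamma> (y u) - f u - w' u \<ge> 0" if "0 < u" "u < 1" "y u - w u > 0" for u
    proof -
      have "0 \<le> w u"
        using w that by (auto simp: supersolution_def)
      then have "c * slope \<gamma> (w u) \<le> c * slope \<gamma> (y u)"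
        using that assms by (intro mult_left_mono slope_mono) auto
      then show ?thesis
        using w'(2)[of u] that by linarith
    qed
    show "((\<lambda>u. y u - w u) \<longlongrightarrow> 0 - l) (at_left 1)"
      by (intro tendsto_diff y l)
  qed (use u l in auto)
  then show ?thesis by simp
qed

lemma profile_supersolution:
  assumes "0 < \<gamma>" "\<gamma> \<le> \<gamma>'" "0 \<le> c'" "c' \<le> c" and y: "profile f \<gamma>' c' y"
  shows "supersolution \<gamma> c y"
  unfolding supersolution_def
proof (intro conjI allI impI)
  fix u :: real assume "0 < u \<and> u < 1"
  then have u: "0 < u" "u < 1" by auto
  have ypos: "0 < y u"
    by (rule profile_pos[OF y u])
  then show "0 \<le> y u" by simp
  have "c' * slope \<gamma>' (y u) \<le> c * slope \<gamma> (y u)"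
    using assms ypos by (intro mult_mono slope_antimono slope_nonneg) auto
  then show "\<exists>w'. (y has_real_derivative w') (at u) \<and> w' \<le> c * slope \<gamma> (y u) - f u"
    using DERIV_profile[OF y u] by (intro exI[of _ "c' * slope \<gamma>' (y u) - f u"]) auto
next
  show "\<exists>l\<ge>0. (y \<longlongrightarrow> l) (at_left 1)"
    using profile_at_1[OF y] by blast
qed

text \<open>Lowering the speed from \<open>c'\<close> to \<open>c\<close> is paid for by a linear term, because \<open>slope \<gamma> \<le> 1 / \<gamma>\<close>. This makes
  the set of wave speeds closed.\<close>

lemma shifted_profile_supersolution:
  assumes "0 < \<gamma>" "0 \<le> c" "c \<le> c'" and y: "profile f \<gamma> c' y"
  shows "supersolution \<gamma> c (\<lambda>u. y u + (c' - c) / \<gamma> * (1 - u))"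
  unfolding supersolution_def
proof (intro conjI allI impI)
  fix u :: real assume "0 < u \<and> u < 1"
  then have u: "0 < u" "u < 1" by auto
  have ypos: "0 < y u"
    by (rule profile_pos[OF y u])
  have shift: "0 \<le> (c' - c) / \<gamma> * (1 - u)"
    using assms u by simp
  then show "0 \<le> y u + (c' - c) / \<gamma> * (1 - u)"
    using ypos by linarith
  have "(c' - c) * slope \<gamma> (y u) \<le> (c' - c) * (1 / \<gamma>)"
    using assms by (intro mult_left_mono slope_le_inverse) auto
  moreover have "c * slope \<gamma> (y u) \<le> c * slope \<gamma> (y u + (c' - c) / \<gamma> * (1 - u))"
    using assms ypos shift by (intro mult_left_mono slope_mono) auto
  moreover have "(c' - c) * (1 / \<gamma>) = - ((c' - c) / \<gamma> * (0 - 1))"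
    by simp
  ultimately have "c' * slope \<gamma> (y u) - f u + (c' - c) / \<gamma> * (0 - 1)
      \<le> c * slope \<gamma> (y u + (c' - c) / \<gamma> * (1 - u)) - f u"
    using left_diff_distrib[of c' c "slope \<gamma> (y u)"] by linarith
  moreover have "((\<lambda>u. y u + (c' - c) / \<gamma> * (1 - u)) has_real_derivative
      c' * slope \<gamma> (y u) - f u + (c' - c) / \<gamma> * (0 - 1)) (at u)"
    by (intro DERIV_add DERIV_profile[OF y] DERIV_cmult DERIV_diff DERIV_const DERIV_ident u)
  ultimately show "\<exists>w'. ((\<lambda>u. y u + (c' - c) / \<gamma> * (1 - u)) has_real_derivative w') (at u) \<and>
      w' \<le> c * slope \<gamma> (y u + (c' - c) / \<gamma> * (1 - u)) - f u"
    by blast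
next
  have "((\<lambda>u. y u + (c' - c) / \<gamma> * (1 - u)) \<longlongrightarrow> 0 + (c' - c) / \<gamma> * (1 - 1)) (at_left 1)"
    by (intro tendsto_intros profile_at_1[OF y])
  then show "\<exists>l\<ge>0. ((\<lambda>u. y u + (c' - c) / \<gamma> * (1 - u)) \<longlongrightarrow> l) (at_left 1)"
    by auto
qed

lemma square_supersolution:
  assumes "0 < \<gamma>" "\<gamma> \<le> 1" "sqrt 2 * (k + 2) * sqrt \<gamma> \<le> c"
  shows "supersolution \<gamma> c (\<lambda>u. u\<^sup>2)"
  unfolding supersolution_def
proof (intro conjI allI impI)
  fix u :: real assume "0 < u \<and> u < 1"
  then have u: "0 < u" "u < 1" by auto
  show "0 \<le> u\<^sup>2" by simp
  have "u\<^sup>2 \<le> 1"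
    using u by (simp add: power_le_one)
  then have "1 + \<gamma> * u\<^sup>2 \<le> 2"
    using mult_mono[of \<gamma> 1 "u\<^sup>2" 1] assms by simp
  then have "sqrt (2 / \<gamma>) / 2 \<le> sqrt (2 / \<gamma>) / (1 + \<gamma> * u\<^sup>2)"
    using assms by (intro divide_left_mono) (auto intro!: add_pos_nonneg)
  then have "sqrt (2 / \<gamma>) / 2 * sqrt (u\<^sup>2) \<le> sqrt (2 / \<gamma>) / (1 + \<gamma> * u\<^sup>2) * sqrt (u\<^sup>2)"
    by (rule mult_right_mono) simp
  also have "\<dots> \<le> slope \<gamma> (u\<^sup>2)"
    using assms by (intro slope_ge) auto
  finally have s: "sqrt (2 / \<gamma>) / 2 * u \<le> slope \<gamma> (u\<^sup>2)"
    using u by simp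
  have "(k + 2) * u = sqrt 2 * (k + 2) * sqrt \<gamma> * (sqrt (2 / \<gamma>) / 2 * u)"
    using assms by (simp add: real_sqrt_divide)
  also have "\<dots> \<le> c * slope \<gamma> (u\<^sup>2)"
    using assms u k_pos by (intro mult_mono s) (auto intro: order_trans[OF _ assms(3)])
  finally have "2 * u \<le> c * slope \<gamma> (u\<^sup>2) - k * u"
    by (simp add: algebra_simps)
  then have "2 * u \<le> c * slope \<gamma> (u\<^sup>2) - f u"
    using bound_0[of u] u by auto
  moreover have "((\<lambda>u. u\<^sup>2) has_real_derivative 2 * u) (at u)"
    by (auto intro!: derivative_eq_intros)
  ultimately show "\<exists>w'. ((\<lambda>u. u\<^sup>2) has_real_derivative w') (at u) \<and> w' \<le> c * slope \<gamma> (u\<^sup>2) - f u"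
    by blast
next
  have "((\<lambda>u::real. u\<^sup>2) \<longlongrightarrow> 1\<^sup>2) (at_left 1)"
    by (intro tendsto_intros)
  then show "\<exists>l\<ge>0. ((\<lambda>u::real. u\<^sup>2) \<longlongrightarrow> l) (at_left 1)"
    by (intro exI[of _ "1\<^sup>2"]) simp
qed

text \<open>For type A the solution starting at \<open>u = 1\<close> with value \<open>0\<close> stays positive down to \<open>u = 0\<close>; only its value
  at \<open>0\<close> is uncertain.\<close>

lemma backward_solution:
  assumes "\<alpha> = 0" "\<gamma> > 0" "c \<ge> 0"
  shows "\<exists>Y. continuous_on {0..1} Y \<and> Y 1 = 0 \<and> (\<forall>u. 0 < u \<and> u < 1 \<longrightarrow>
    Y u > 0 \<and> (Y has_real_derivative c * slope \<gamma> (Y u) - f u) (at u))"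
proof -
  \<comment> \<open>Time runs backward from \<open>u = 1\<close>; negative values of the unknown are truncated in the field, and ruled
      out only afterwards.\<close>
  define h where "h = (\<lambda>t y. extension (1 - t) - c * slope \<gamma> (max y 0))"
  have "continuous_on UNIV (\<lambda>x::real. slope \<gamma> (max x 0))"
    by (rule continuous_on_compose2[OF continuous_on_slope[OF assms(2)]])
      (auto intro!: continuous_intros)
  then have "continuous_on ({0..1} \<times> UNIV) (\<lambda>p::real \<times> real. slope \<gamma> (max (snd p) 0))"
    by (rule continuous_on_compose2) (auto intro!: continuous_intros)
  moreover have "continuous_on ({0..1} \<times> UNIV) (\<lambda>p::real \<times> real. extension (1 - fst p))"
    by (rule continuous_on_compose2[OF continuous_extension[of UNIV]]) (auto intro!: continuous_intros)
  ultimately have "continuous_on ({0..1} \<times> UNIV) (\<lambda>(t, y). h t y)"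
    unfolding h_def case_prod_unfold by (intro continuous_intros)
  moreover have "\<bar>h t y\<bar> \<le> k + c * (1 / \<gamma>)" if "t \<in> {0..1}" for t y
  proof -
    have "\<bar>extension (1 - t)\<bar> \<le> k"
      unfolding extension_def by (rule bound) auto
    moreover have "0 \<le> c * slope \<gamma> (max y 0)" "c * slope \<gamma> (max y 0) \<le> c * (1 / \<gamma>)"
      using assms by (auto intro!: mult_left_mono slope_le_inverse mult_nonneg_nonneg slope_nonneg
          simp del: times_divide_eq_right)
    ultimately show ?thesis
      unfolding h_def by linarith
  qed
  ultimately obtain Z where Z: "Z 0 = 0"
    "\<And>t. t \<in> {0..1} \<Longrightarrow> (Z has_real_derivative h t (Z t)) (at t within {0..1})"
    using peano[of h "k + c * (1 / \<gamma>)" 0] by blast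
  define Y where "Y = (\<lambda>u. Z (1 - u))"
  have "continuous_on {0..1} Z"
    by (rule DERIV_continuous_on[OF Z(2)])
  then have cont_Y: "continuous_on {0..1} Y"
    using continuous_on_compose2[of "{0..1}" Z "{0..1}" "\<lambda>u. 1 - u"]
    by (simp add: Y_def continuous_on_diff image_subset_iff)
  have Y1: "Y 1 = 0"
    by (simp add: Y_def Z)
  have Y': "(Y has_real_derivative c * slope \<gamma> (max (Y u) 0) - f u) (at u)" if "0 < u" "u < 1" for u
  proof -
    have "(Z has_real_derivative h (1 - u) (Z (1 - u))) (at (1 - u))"
      using Z(2)[of "1 - u"] that by (simp add: at_within_Icc_at)
    from DERIV_chain2[OF this DERIV_diff[OF DERIV_const DERIV_ident]] show ?thesis
      using that by (simp add: Y_def h_def extension_eq)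
  qed
  have lim: "(Y \<longlongrightarrow> 0) (at_left 1)"
    using continuous_on_Icc_at_leftD[OF cont_Y] Y1 by simp
  have Y0: "0 \<le> Y u" if u: "0 < u" "u < 1" for u
  proof -
    have "- Y u \<le> 0"
    proof (rule comparison_backward[where D = "\<lambda>u. - Y u" and u = u and a = 0 and b = 1 and l = "- 0"
          and D' = "\<lambda>u. - (c * slope \<gamma> (max (Y u) 0) - f u)"])
      show "- (c * slope \<gamma> (max (Y u) 0) - f u) \<ge> 0" if "0 < u" "u < 1" "- Y u > 0" for u
        using pos[of u] that assms by simp
      show "((\<lambda>u. - Y u) has_real_derivative - (c * slope \<gamma> (max (Y u) 0) - f u)) (at u)"
        if "0 < u" "u < 1" for u
        by (rule DERIV_minus[OF Y'[OF that]])
      show "((\<lambda>u. - Y u) \<longlongrightarrow> - 0) (at_left 1)"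
        by (rule tendsto_minus[OF lim])
    qed (use u in auto)
    then show ?thesis by simp
  qed
  have Y_pos: "Y u > 0" if u: "0 < u" "u < 1" for u
  proof (rule ccontr)
    assume "\<not> Y u > 0"
    then have "Y u = 0"
      using Y0[OF u] by simp
    moreover have "c * slope \<gamma> (max (Y u) 0) - f u = 0"
    proof (rule DERIV_local_min[OF Y'[OF u]])
      show "0 < min u (1 - u)"
        using u by simp
      show "\<forall>s. \<bar>u - s\<bar> < min u (1 - u) \<longrightarrow> Y u \<le> Y s"
        using Y0 \<open>Y u = 0\<close> by auto
    qed
    ultimately show False
      using pos[of u] u assms by simp
  qed
  have "(Y has_real_derivative c * slope \<gamma> (Y u) - f u) (at u)" if "0 < u" "u < 1" for u
    using Y'[OF that] Y_pos[OF that] by simp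
  then show ?thesis
    using cont_Y Y1 Y_pos by blast
qed

lemma profile_if_supersolutions:
  assumes "\<alpha> = 0" "\<gamma> > 0" "c \<ge> 0"
    and super: "\<And>e. e > 0 \<Longrightarrow> \<exists>w l. supersolution \<gamma> c w \<and> (w \<longlongrightarrow> l) (at_right 0) \<and> l \<le> e"
  shows "\<exists>y. profile f \<gamma> c y"
proof -
  obtain Y where cont_Y: "continuous_on {0..1} Y" and Y1: "Y 1 = 0"
    and Y: "\<And>u. 0 < u \<Longrightarrow> u < 1 \<Longrightarrow> Y u > 0"
      "\<And>u. 0 < u \<Longrightarrow> u < 1 \<Longrightarrow> (Y has_real_derivative c * slope \<gamma> (Y u) - f u) (at u)"
    using backward_solution[OF assms(1-3)] by blast
  have lim1: "(Y \<longlongrightarrow> 0) (at_left 1)"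
    using continuous_on_Icc_at_leftD[OF cont_Y] Y1 by simp
  have lim0: "(Y \<longlongrightarrow> Y 0) (at_right 0)"
    using continuous_on_Icc_at_rightD[OF cont_Y] by simp
  have ev: "\<forall>\<^sub>F u::real in at_right 0. 0 < u \<and> u < 1"
    using eventually_at_right_real[OF zero_less_one] by simp
  have "Y 0 \<le> 0"
  proof (rule field_le_epsilon)
    fix e :: real assume "e > 0"
    from super[OF this] obtain w l where w: "supersolution \<gamma> c w" "(w \<longlongrightarrow> l) (at_right 0)" "l \<le> e"
      by blast
    have "\<forall>\<^sub>F u in at_right 0. Y u \<le> w u"
      using ev by eventually_elim (use le_supersolution[OF assms(2,3) w(1) Y(2) lim1] in blast)
    then have "Y 0 \<le> l"
      by (rule tendsto_le[OF _ w(2) lim0, rotated]) simp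
    then show "Y 0 \<le> 0 + e"
      using w(3) by simp
  qed
  moreover have "0 \<le> Y 0"
    by (rule tendsto_lowerbound[OF lim0]) (use ev Y(1) in \<open>auto elim!: eventually_mono intro: less_imp_le\<close>)
  ultimately have "(Y \<longlongrightarrow> 0) (at_right 0)"
    using lim0 by simp
  then show ?thesis
    unfolding profile_def using lim1 Y by blast
qed

lemma heteroclinic_imp_profile:
  assumes "\<gamma> > 0" "heteroclinic f \<gamma> c v"
  shows "c \<ge> 0" "\<exists>y. profile f \<gamma> c y \<and> (\<forall>z. 0 < v z \<and> v z < 1 \<longrightarrow> deriv v z = slope \<gamma> (y (v z)))"
proof -
  interpret wave f k \<alpha> \<gamma> c v
    by unfold_locales (rule assms)+
  show "c \<ge> 0"
    by (rule speed_nonneg)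
  show "\<exists>y. profile f \<gamma> c y \<and> (\<forall>z. 0 < v z \<and> v z < 1 \<longrightarrow> deriv v z = slope \<gamma> (y (v z)))"
    by (rule has_profile)
qed

lemma wave_speeds_iff:
  "\<gamma> > 0 \<Longrightarrow> c \<in> wave_speeds f \<gamma> \<longleftrightarrow> c \<ge> 0 \<and> (\<exists>y. profile f \<gamma> c y)"
  unfolding wave_speeds_def using heteroclinic_imp_profile profile_imp_heteroclinic by blast

text \<open>For type A the set of wave speeds is an upper set and shrinks as \<open>\<gamma>\<close> grows: a profile for \<open>\<gamma>'\<close> and \<open>c'\<close> is a
  supersolution for \<open>\<gamma>\<close> and \<open>c\<close>.\<close>

lemma wave_speeds_upward:
  assumes "\<alpha> = 0" "0 < \<gamma>" "\<gamma> \<le> \<gamma>'" "c' \<in> wave_speeds f \<gamma>'" "c' \<le> c"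
  shows "c \<in> wave_speeds f \<gamma>"
proof -
  have "c' \<ge> 0" and "\<exists>y. profile f \<gamma>' c' y"
    using assms wave_speeds_iff[of \<gamma>' c'] by auto
  then obtain y where y: "profile f \<gamma>' c' y" by blast
  have "\<exists>y. profile f \<gamma> c y"
  proof (rule profile_if_supersolutions)
    show "\<exists>w l. supersolution \<gamma> c w \<and> (w \<longlongrightarrow> l) (at_right 0) \<and> l \<le> e" if "e > 0" for e
      using profile_supersolution[OF assms(2,3) \<open>c' \<ge> 0\<close> assms(5) y] profile_at_0[OF y] that
      by (intro exI[of _ y] exI[of _ 0]) auto
  qed (use assms \<open>c' \<ge> 0\<close> in auto)
  then show ?thesis
    using assms \<open>c' \<ge> 0\<close> by (simp add: wave_speeds_iff)
qed

lemma wave_speeds_eq_atLeast: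
  assumes "\<alpha> = 0" "\<gamma> > 0" and S: "wave_speeds f \<gamma> \<noteq> {}"
  shows "wave_speeds f \<gamma> = {Inf (wave_speeds f \<gamma>)..}"
proof -
  define c where "c = Inf (wave_speeds f \<gamma>)"
  have bdd: "bdd_below (wave_speeds f \<gamma>)"
    using assms(2) by (intro bdd_belowI[of _ 0]) (simp add: wave_speeds_iff)
  have "c \<ge> 0"
    unfolding c_def using assms by (intro cInf_greatest) (auto simp: wave_speeds_iff)
  have "\<exists>y. profile f \<gamma> c y"
  proof (rule profile_if_supersolutions[OF assms(1,2) \<open>c \<ge> 0\<close>])
    fix e :: real assume "e > 0"
    then have "Inf (wave_speeds f \<gamma>) < c + \<gamma> * e"
      using assms(2) by (simp add: c_def)
    then obtain c' where c': "c' \<in> wave_speeds f \<gamma>" "c' < c + \<gamma> * e"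
      using cInf_lessD[OF S] by blast
    then have "c \<le> c'"
      unfolding c_def using bdd by (intro cInf_lower)
    obtain y where y: "profile f \<gamma> c' y"
      using c'(1) assms(2) by (auto simp: wave_speeds_iff)
    have "((\<lambda>u. y u + (c' - c) / \<gamma> * (1 - u)) \<longlongrightarrow> 0 + (c' - c) / \<gamma> * (1 - 0)) (at_right 0)"
      by (intro tendsto_intros profile_at_0[OF y])
    moreover have "0 + (c' - c) / \<gamma> * (1 - 0) \<le> e"
      using c'(2) assms(2) by (simp add: divide_le_eq mult.commute)
    ultimately show "\<exists>w l. supersolution \<gamma> c w \<and> (w \<longlongrightarrow> l) (at_right 0) \<and> l \<le> e"
      using shifted_profile_supersolution[OF assms(2) \<open>c \<ge> 0\<close> \<open>c \<le> c'\<close> y] by blast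
  qed
  then have "c \<in> wave_speeds f \<gamma>"
    using assms(2) \<open>c \<ge> 0\<close> by (simp add: wave_speeds_iff)
  then have "{c..} \<subseteq> wave_speeds f \<gamma>"
    using wave_speeds_upward[OF assms(1,2) order_refl] by auto
  moreover have "wave_speeds f \<gamma> \<subseteq> {c..}"
    using bdd by (auto simp: c_def intro: cInf_lower)
  ultimately show ?thesis
    by (auto simp: c_def)
qed

text \<open>The definite description of the critical speed denotes, because the infimum of the wave speeds is itself a
  wave speed.\<close>

lemma critical_speed_type_A:
  assumes "\<alpha> = 0" "\<gamma> > 0" "type_A f" "wave_speeds f \<gamma> \<noteq> {}"
  shows "wave_speeds f \<gamma> = {critical_speed f \<gamma>..}"
proof -
  have "wave_speeds f \<gamma> = {(THE c. wave_speeds f \<gamma> = {c..})..}"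
    by (rule theI[of "\<lambda>c. wave_speeds f \<gamma> = {c..}"]) (use wave_speeds_eq_atLeast[OF assms(1,2,4)] in auto)
  then show ?thesis
    using assms(3) by (simp add: critical_speed_def)
qed

lemma sqrt_wave_speed:
  assumes "\<alpha> = 0" "0 < \<gamma>" "\<gamma> \<le> 1"
  shows "sqrt 2 * (k + 2) * sqrt \<gamma> \<in> wave_speeds f \<gamma>"
proof -
  define c where "c = sqrt 2 * (k + 2) * sqrt \<gamma>"
  have "c \<ge> 0"
    using assms k_pos by (simp add: c_def)
  have "((\<lambda>u::real. u\<^sup>2) \<longlongrightarrow> 0\<^sup>2) (at_right 0)"
    by (intro tendsto_intros)
  then have "\<exists>y. profile f \<gamma> c y"
    using assms square_supersolution[of \<gamma> c] \<open>c \<ge> 0\<close>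
    by (intro profile_if_supersolutions) (auto simp: c_def intro!: exI[of _ "\<lambda>u. u\<^sup>2"] exI[of _ 0])
  then show ?thesis
    using assms \<open>c \<ge> 0\<close> by (simp add: wave_speeds_iff c_def)
qed

end

section \<open>Comparison and bounds of speeds\<close>

context reaction
begin

text \<open>If \<open>c1 > c2\<close>, backward comparison gives \<open>y1 \<le> y2\<close>, and forward comparison of the square roots on
  \<open>(0, \<alpha>)\<close> gives the reverse. So both profiles agree there, which is incompatible with their equations.\<close>

lemma profile_speed_le:
  assumes "\<alpha> > 0" "0 < \<gamma>1" "\<gamma>1 \<le> \<gamma>2" "0 \<le> c2"
    and y1: "profile f \<gamma>1 c1 y1" and y2: "profile f \<gamma>2 c2 y2"
  shows "c1 \<le> c2"
proof (rule ccontr)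
  assume "\<not> c1 \<le> c2"
  then have c: "c2 < c1" "0 \<le> c1"
    using assms by auto
  have super: "supersolution \<gamma>1 c1 y2"
    using profile_supersolution[OF assms(2,3,4) _ y2] c by simp
  have le: "y1 u \<le> y2 u" if "0 < u" "u < 1" for u
    by (rule le_supersolution[OF assms(2) c(2) super DERIV_profile[OF y1] profile_at_1[OF y1] that])
  have ge: "sqrt (y2 u) - sqrt (y1 u) \<le> 0" if u: "0 < u" "u < \<alpha>" for u
  proof (rule comparison_forward[where D = "\<lambda>u. sqrt (y2 u) - sqrt (y1 u)" and u = u and a = 0
        and b = \<alpha> and l = "sqrt 0 - sqrt 0"
        and D' = "\<lambda>u. (c2 * slope \<gamma>2 (y2 u) - f u) / (2 * sqrt (y2 u)) -
          (c1 * slope \<gamma>1 (y1 u) - f u) / (2 * sqrt (y1 u))"])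
    show "((\<lambda>u. sqrt (y2 u) - sqrt (y1 u)) has_real_derivative
        (c2 * slope \<gamma>2 (y2 u) - f u) / (2 * sqrt (y2 u)) -
          (c1 * slope \<gamma>1 (y1 u) - f u) / (2 * sqrt (y1 u))) (at u)" if "0 < u" "u < \<alpha>" for u
      using that alpha by (intro DERIV_diff DERIV_sqrt_profile[OF y1] DERIV_sqrt_profile[OF y2]) auto
    show "(c2 * slope \<gamma>2 (y2 u) - f u) / (2 * sqrt (y2 u)) -
          (c1 * slope \<gamma>1 (y1 u) - f u) / (2 * sqrt (y1 u)) \<le> 0"
      if u: "0 < u" "u < \<alpha>" and D: "sqrt (y2 u) - sqrt (y1 u) > 0" for u
    proof -
      have p: "y1 u > 0" "y2 u > 0"
        using profile_pos[OF y1] profile_pos[OF y2] u alpha by auto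
      have D': "y1 u < y2 u"
        using D by simp
      have "c2 * slope \<gamma>2 (y2 u) / (2 * sqrt (y2 u)) = c2 * slope_factor \<gamma>2 (y2 u) / 2"
        "c1 * slope \<gamma>1 (y1 u) / (2 * sqrt (y1 u)) = c1 * slope_factor \<gamma>1 (y1 u) / 2"
        using p assms by (auto simp: slope_eq_factor)
      moreover have "c2 * slope_factor \<gamma>2 (y2 u) \<le> c1 * slope_factor \<gamma>1 (y1 u)"
        using c assms p D' by (intro mult_mono slope_factor_antimono slope_factor_nonneg) auto
      moreover have "f u / (2 * sqrt (y1 u)) \<le> f u / (2 * sqrt (y2 u))"
        using nonpos[of u] u p D by (intro divide_left_mono_neg) auto
      ultimately show ?thesis
        unfolding diff_divide_distrib by linarith
    qed
    show "((\<lambda>u. sqrt (y2 u) - sqrt (y1 u)) \<longlongrightarrow> sqrt 0 - sqrt 0) (at_right 0)"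
      by (intro tendsto_intros profile_at_0[OF y1] profile_at_0[OF y2])
  qed (use u in auto)
  have eq: "y1 u = y2 u" if "0 < u" "u < \<alpha>" for u
    using le[of u] ge[of u] that alpha by (intro antisym) auto
  define u where "u = \<alpha> / 2"
  have u: "0 < u" "u < \<alpha>" "u < 1"
    using assms(1) alpha by (auto simp: u_def)
  have "(y2 has_real_derivative c1 * slope \<gamma>1 (y1 u) - f u) (at u)"
    by (rule has_field_derivative_transform_within_open[OF DERIV_profile[OF y1, of u], of "{0<..<\<alpha>}"])
      (use u eq in auto)
  then have "c1 * slope \<gamma>1 (y1 u) - f u = c2 * slope \<gamma>2 (y2 u) - f u"
    using DERIV_profile[OF y2, of u] u DERIV_unique by blast
  moreover have "c2 * slope \<gamma>2 (y2 u) < c1 * slope \<gamma>1 (y1 u)"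
  proof -
    have p: "y1 u > 0"
      using profile_pos[OF y1] u by simp
    have "c2 * slope \<gamma>2 (y2 u) \<le> c2 * slope \<gamma>1 (y1 u)"
      using eq[of u] u assms p by (intro mult_left_mono) (auto intro: slope_antimono)
    also have "\<dots> < c1 * slope \<gamma>1 (y1 u)"
      using c slope_pos[OF assms(2) p] by simp
    finally show ?thesis .
  qed
  ultimately show False by simp
qed

text \<open>Where \<open>f \<le> 0\<close>, the derivative of \<open>sqrt y\<close> is at least \<open>c * slope_factor \<gamma> y / 2\<close>.\<close>

lemma sqrt_profile_ge_left:
  assumes "\<gamma> > 0" "c \<ge> 0" and y: "profile f \<gamma> c y"
    and m: "\<And>u. 0 < u \<Longrightarrow> u < 1 \<Longrightarrow> y u \<le> m"
    and u: "0 < u" "u < \<alpha>"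
  shows "c * (sqrt (2 / \<gamma>) / (1 + \<gamma> * m)) / 2 * u \<le> sqrt (y u)"
proof -
  define B where "B = c * (sqrt (2 / \<gamma>) / (1 + \<gamma> * m)) / 2"
  have "B * u - sqrt (y u) \<le> 0"
  proof (rule comparison_forward[where D = "\<lambda>u. B * u - sqrt (y u)" and u = u and a = 0 and b = \<alpha>
        and l = "B * 0 - sqrt 0"
        and D' = "\<lambda>u. B - (c * slope \<gamma> (y u) - f u) / (2 * sqrt (y u))"])
    show "((\<lambda>u. B * u - sqrt (y u)) has_real_derivative
        B - (c * slope \<gamma> (y u) - f u) / (2 * sqrt (y u))) (at u)" if "0 < u" "u < \<alpha>" for u
      using DERIV_diff[OF DERIV_cmult_Id[of B] DERIV_sqrt_profile[OF y, of u]] that alpha by simp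
    show "B - (c * slope \<gamma> (y u) - f u) / (2 * sqrt (y u)) \<le> 0" if u: "0 < u" "u < \<alpha>" for u
    proof -
      have p: "y u > 0" "y u \<le> m"
        using profile_pos[OF y] m u alpha by auto
      then have "sqrt (2 / \<gamma>) / (1 + \<gamma> * m) \<le> sqrt (2 / \<gamma>) / (1 + \<gamma> * y u)"
        using assms(1) by (intro divide_left_mono add_left_mono mult_left_mono mult_pos_pos add_pos_nonneg) auto
      also have "\<dots> \<le> slope_factor \<gamma> (y u)"
        using assms(1) p by (intro slope_factor_ge) auto
      finally have "B \<le> c * slope_factor \<gamma> (y u) / 2"
        using assms(2) unfolding B_def by (intro divide_right_mono mult_left_mono) auto
      also have "\<dots> = c * slope \<gamma> (y u) / (2 * sqrt (y u))"
        using p assms(1) by (simp add: slope_eq_factor)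
      also have "\<dots> \<le> (c * slope \<gamma> (y u) - f u) / (2 * sqrt (y u))"
        using nonpos[of u] u p by (intro divide_right_mono) auto
      finally show ?thesis by simp
    qed
    show "((\<lambda>u. B * u - sqrt (y u)) \<longlongrightarrow> B * 0 - sqrt 0) (at_right 0)"
      by (intro tendsto_intros profile_at_0[OF y])
  qed (use u in auto)
  then show ?thesis
    by (simp add: B_def)
qed

text \<open>If the speed were larger, the profile would lie below \<open>u\<^sup>2\<close>, while \<open>sqrt y\<close> would grow faster than \<open>u\<close> on
  \<open>(0, \<alpha>)\<close>.\<close>

lemma profile_speed_upper:
  assumes "\<alpha> > 0" "0 < \<gamma>" "\<gamma> \<le> 1" and y: "profile f \<gamma> c y"
  shows "c \<le> sqrt 2 * (k + 2) * sqrt \<gamma>"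
proof (rule ccontr)
  assume "\<not> ?thesis"
  then have c: "sqrt 2 * (k + 2) * sqrt \<gamma> < c" by simp
  moreover have "0 \<le> sqrt 2 * (k + 2) * sqrt \<gamma>"
    using assms k_pos by simp
  ultimately have c0: "c \<ge> 0" by simp
  have sq: "y u \<le> u\<^sup>2" if "0 < u" "u < 1" for u
    by (rule le_supersolution[OF assms(2) c0 square_supersolution DERIV_profile[OF y] profile_at_1[OF y]])
      (use assms c that in auto)
  have le1: "y u \<le> 1" if "0 < u" "u < 1" for u
    using sq[OF that] that by (meson order_trans power_le_one less_imp_le)
  define u where "u = \<alpha> / 2"
  have u: "0 < u" "u < \<alpha>" "u < 1"
    using assms(1) alpha by (auto simp: u_def)
  have "c * (sqrt (2 / \<gamma>) / (1 + \<gamma> * 1)) / 2 * u \<le> sqrt (y u)"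
    by (rule sqrt_profile_ge_left[OF assms(2) c0 y le1 u(1,2)])
  also have "\<dots> \<le> u"
    using sq[of u] u by (intro real_le_lsqrt) auto
  finally have "c * (sqrt (2 / \<gamma>) / (1 + \<gamma> * 1)) / 2 * u \<le> 1 * u" by simp
  from mult_right_le_imp_le[OF this u(1)]
  have *: "c * (sqrt (2 / \<gamma>) / (1 + \<gamma>)) \<le> 2"
    unfolding mult_1_right by (subst (asm) divide_le_eq_1_pos) simp_all
  have "c * (sqrt (2 / \<gamma>) / 2) \<le> c * (sqrt (2 / \<gamma>) / (1 + \<gamma>))"
    using assms c0 by (intro mult_left_mono divide_left_mono) auto
  also note *
  finally have "c * sqrt (2 / \<gamma>) \<le> 4" by simp
  moreover have "sqrt 2 * (k + 2) * sqrt \<gamma> * sqrt (2 / \<gamma>) < c * sqrt (2 / \<gamma>)"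
    using c assms by (intro mult_strict_right_mono) auto
  moreover have "sqrt 2 * (k + 2) * sqrt \<gamma> * sqrt (2 / \<gamma>) = (sqrt 2)\<^sup>2 * (k + 2)"
    using assms by (simp add: real_sqrt_divide power2_eq_square del: real_sqrt_mult_self real_sqrt_pow2)
  ultimately show False
    using k_pos by simp
qed

lemma profile_le_half:
  assumes "\<gamma> > 0" "c \<ge> 0" "profile f \<gamma> c y" "0 < u" "u < 1"
  shows "y u \<le> k / 2"
proof -
  have "k / 2 * (1 - u)\<^sup>2 \<le> k / 2 * 1"
    using assms k_pos by (intro mult_left_mono power_le_one) auto
  then show ?thesis
    using profile_le_right[OF assms] by simp
qed

lemma profile_speed_lower:
  assumes "\<gamma> > 0" "c \<ge> 0" and y: "profile f \<gamma> c y"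
  shows "integral {0..1} f \<le> c * sqrt (k / \<gamma>)"
proof -
  define D where "D = (\<lambda>u. y u + primitive u - primitive 0 - c * sqrt (k / \<gamma>) * u)"
  have P: "isCont primitive u" for u
    using DERIV_isCont[OF DERIV_primitive] .
  have "D u \<le> 0" if u: "0 < u" "u < 1" for u
  proof (rule comparison_forward[where D = D and u = u and a = 0 and b = 1
        and D' = "\<lambda>u. c * slope \<gamma> (y u) - c * sqrt (k / \<gamma>)"
        and l = "0 + primitive 0 - primitive 0 - c * sqrt (k / \<gamma>) * 0"])
    show "(D has_real_derivative c * slope \<gamma> (y u) - c * sqrt (k / \<gamma>)) (at u)" if "0 < u" "u < 1" for u
      unfolding D_def using that
      by (auto intro!: derivative_eq_intros DERIV_profile[OF y] DERIV_primitive simp: extension_eq)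
    show "c * slope \<gamma> (y u) - c * sqrt (k / \<gamma>) \<le> 0" if u: "0 < u" "u < 1" for u
    proof -
      have "y u \<le> k / 2"
        by (rule profile_le_half[OF assms u])
      then have "sqrt (2 / \<gamma>) * sqrt (y u) \<le> sqrt (2 / \<gamma>) * sqrt (k / 2)"
        using assms(1) by (intro mult_left_mono) auto
      also have "\<dots> = sqrt (k / \<gamma>)"
        unfolding real_sqrt_mult[symmetric] by simp
      finally have "slope \<gamma> (y u) \<le> sqrt (k / \<gamma>)"
        using slope_le[OF assms(1)] profile_pos[OF y u] by (meson less_imp_le order_trans)
      then show ?thesis
        using assms(2) by (simp add: mult_left_mono)
    qed
    show "(D \<longlongrightarrow> 0 + primitive 0 - primitive 0 - c * sqrt (k / \<gamma>) * 0) (at_right 0)"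
      unfolding D_def
      by (intro tendsto_intros profile_at_0[OF y] isCont_tendsto_compose[OF P])
  qed (use u in auto)
  then have "\<forall>\<^sub>F u in at_left 1. D u \<le> 0"
    using eventually_at_left_real[OF zero_less_one] by (auto elim!: eventually_mono)
  moreover have "(D \<longlongrightarrow> 0 + primitive 1 - primitive 0 - c * sqrt (k / \<gamma>) * 1) (at_left 1)"
    unfolding D_def
    by (intro tendsto_intros profile_at_1[OF y] isCont_tendsto_compose[OF P])
  ultimately have "0 + primitive 1 - primitive 0 - c * sqrt (k / \<gamma>) * 1 \<le> 0"
    by (intro tendsto_upperbound) auto
  then show ?thesis
    using primitive_mass by simp
qed

section \<open>Lower bounds for profiles, uniform in the parameter\<close>

lemma profile_plus_primitive_mono:
  assumes "\<gamma> > 0" "c \<ge> 0" and y: "profile f \<gamma> c y" and "0 < s" "s \<le> t" "t < 1"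
  shows "y s + primitive s \<le> y t + primitive t"
proof (rule DERIV_nonneg_imp_nondecreasing[OF assms(5)])
  fix x assume "s \<le> x" "x \<le> t"
  then have x: "0 < x" "x < 1"
    using assms by auto
  have "((\<lambda>u. y u + primitive u) has_real_derivative c * slope \<gamma> (y x)) (at x)"
    using DERIV_add[OF DERIV_profile[OF y x] DERIV_primitive] x by (simp add: extension_eq)
  moreover have "0 \<le> c * slope \<gamma> (y x)"
    using assms profile_pos[OF y x] by (simp add: slope_nonneg)
  ultimately show "\<exists>d. ((\<lambda>u. y u + primitive u) has_real_derivative d) (at x) \<and> 0 \<le> d"
    by blast
qed

lemma profile_ge_shift:
  assumes "\<gamma> > 0" "c \<ge> 0" and y: "profile f \<gamma> c y" and "0 < s" "s \<le> t" "t < 1"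
  shows "y s - k * (t - s) \<le> y t"
proof -
  have "primitive t - k * t \<le> primitive s - k * s"
  proof (rule DERIV_nonpos_imp_nonincreasing[OF assms(5), where f = "\<lambda>u. primitive u - k * u"])
    fix x
    have "((\<lambda>u. primitive u - k * u) has_real_derivative extension x - k) (at x)"
      by (intro DERIV_diff DERIV_primitive DERIV_cmult_Id)
    moreover have "\<bar>extension x\<bar> \<le> k"
      unfolding extension_def by (rule bound) auto
    ultimately show "\<exists>d. ((\<lambda>u. primitive u - k * u) has_real_derivative d) (at x) \<and> d \<le> 0"
      by (intro exI[of _ "extension x - k"]) auto
  qed
  then show ?thesis
    using profile_plus_primitive_mono[OF assms] by (simp add: algebra_simps)
qed

lemma profile_ge_primitive:
  assumes "\<gamma> > 0" "c \<ge> 0" and y: "profile f \<gamma> c y" and u: "0 < u" "u < 1"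
  shows "primitive 0 - primitive u \<le> y u"
proof -
  have P: "isCont primitive u" for u
    using DERIV_isCont[OF DERIV_primitive] .
  have "((\<lambda>s. y s + primitive s) \<longlongrightarrow> 0 + primitive 0) (at_right 0)"
    by (intro tendsto_intros profile_at_0[OF y] isCont_tendsto_compose[OF P])
  moreover have "\<forall>\<^sub>F s in at_right 0. y s + primitive s \<le> y u + primitive u"
    using eventually_at_right_real[OF u(1)]
    by eventually_elim (use profile_plus_primitive_mono[OF assms(1-3)] u in auto)
  ultimately have "0 + primitive 0 \<le> y u + primitive u"
    by (rule tendsto_upperbound) simp
  then show ?thesis by simp
qed

text \<open>Profiles with \<open>\<gamma> \<le> 1\<close> whose speed obeys the bound of order \<open>sqrt \<gamma>\<close>. All lower bounds below are uniform
  over this class.\<close>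

definition slow_profile :: "real \<Rightarrow> real \<Rightarrow> (real \<Rightarrow> real) \<Rightarrow> bool" where
  "slow_profile \<gamma> c y \<longleftrightarrow> 0 < \<gamma> \<and> \<gamma> \<le> 1 \<and> 0 \<le> c \<and> c \<le> sqrt 2 * (k + 2) * sqrt \<gamma> \<and> profile f \<gamma> c y"

text \<open>To the right of \<open>\<alpha>\<close>, a value of the profile too small would make the profile decrease with a definite slope
  and vanish before \<open>u = 1\<close>: the line \<open>\<mu> * (b' - u)\<close> is a lower barrier.\<close>

lemma slow_profile_ge_right:
  assumes "\<alpha> < a" "a \<le> b" "b < 1"
  shows "\<exists>m>0. \<forall>\<gamma> c y. slow_profile \<gamma> c y \<longrightarrow> (\<forall>u. a \<le> u \<and> u \<le> b \<longrightarrow> m \<le> y u)"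
proof -
  define a' where "a' = (\<alpha> + a) / 2"
  define b' where "b' = (b + 1) / 2"
  have ab: "\<alpha> < a'" "a' < a" "b < b'" "b' < 1" "0 < a'"
    using assms alpha by (auto simp: a'_def b'_def)
  have "continuous_on {a'..b'} f"
    using ab assms by (intro continuous_on_subset[OF cont]) auto
  then obtain x where x: "x \<in> {a'..b'}" "\<And>u. u \<in> {a'..b'} \<Longrightarrow> f x \<le> f u"
    using continuous_attains_inf[of "{a'..b'}" f] ab assms by auto
  have fx: "f x > 0"
    using pos[of x] x(1) ab by auto
  \<comment> \<open>As long as \<open>y u \<le> r\<^sup>2\<close>, the term \<open>c * slope \<gamma> (y u)\<close> is at most half of the minimum \<open>f x\<close> of \<open>f\<close>.\<close>
  define r where "r = f x / (4 * (k + 2))"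
  define \<mu> where "\<mu> = min (f x / 2) (r\<^sup>2)"
  have r: "r > 0"
    using fx k_pos by (simp add: r_def)
  have mu: "\<mu> > 0" "\<mu> \<le> f x / 2" "\<mu> \<le> r\<^sup>2"
    using fx r by (auto simp: \<mu>_def)
  have "\<mu> * (b' - b) \<le> y u" if slow: "slow_profile \<gamma> c y" and u: "a \<le> u" "u \<le> b" for \<gamma> c y u
  proof -
    have \<gamma>: "0 < \<gamma>" and c: "0 \<le> c" "c \<le> sqrt 2 * (k + 2) * sqrt \<gamma>" and y: "profile f \<gamma> c y"
      using slow by (auto simp: slow_profile_def)
    have "\<mu> * (b' - u) - y u \<le> 0"
    proof (rule comparison_backward[where D = "\<lambda>u. \<mu> * (b' - u) - y u" and u = u and a = a' and b = b'
          and l = "\<mu> * (b' - b') - y b'" and D' = "\<lambda>u. \<mu> * (0 - 1) - (c * slope \<gamma> (y u) - f u)"])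
      show "((\<lambda>u. \<mu> * (b' - u) - y u) has_real_derivative
          \<mu> * (0 - 1) - (c * slope \<gamma> (y u) - f u)) (at u)" if "a' < u" "u < b'" for u
        using that ab
        by (intro DERIV_diff DERIV_cmult DERIV_const DERIV_ident DERIV_profile[OF y]) auto
      show "0 \<le> \<mu> * (0 - 1) - (c * slope \<gamma> (y u) - f u)"
        if u: "a' < u" "u < b'" and D: "\<mu> * (b' - u) - y u > 0" for u
      proof -
        have ypos: "y u > 0"
          using profile_pos[OF y, of u] u ab by simp
        have "\<mu> * (b' - u) \<le> \<mu> * 1"
          using mu u ab by (intro mult_left_mono) auto
        then have "y u \<le> r\<^sup>2"
          using D mu by linarith
        then have "sqrt (y u) \<le> r"
          using r by (simp add: real_le_lsqrt)
        have "c * slope \<gamma> (y u) \<le> (sqrt 2 * (k + 2) * sqrt \<gamma>) * (sqrt (2 / \<gamma>) * sqrt (y u))"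
          using c \<gamma> ypos k_pos by (intro mult_mono slope_le slope_nonneg) auto
        also have "\<dots> = (sqrt 2)\<^sup>2 * (k + 2) * sqrt (y u)"
          using \<gamma> by (simp add: real_sqrt_divide power2_eq_square del: real_sqrt_mult_self real_sqrt_pow2)
        also have "\<dots> \<le> 2 * (k + 2) * r"
          using k_pos \<open>sqrt (y u) \<le> r\<close> by simp
        also have "\<dots> = f x / 2"
          using k_pos by (simp add: r_def field_simps)
        finally show ?thesis
          using x(2)[of u] u mu by auto
      qed
      have "isCont y b'"
        using DERIV_isCont[OF DERIV_profile[OF y, of b']] ab assms alpha by auto
      then have "(y \<longlongrightarrow> y b') (at_left b')"
        by (simp add: isCont_def filterlim_at_split)
      then show "((\<lambda>u. \<mu> * (b' - u) - y u) \<longlongrightarrow> \<mu> * (b' - b') - y b') (at_left b')"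
        by (intro tendsto_intros)
      show "\<mu> * (b' - b') - y b' \<le> 0"
        using profile_pos[OF y, of b'] ab assms alpha by auto
    qed (use u ab in auto)
    moreover have "\<mu> * (b' - b) \<le> \<mu> * (b' - u)"
      using mu u by (intro mult_left_mono) auto
    ultimately show ?thesis by simp
  qed
  moreover have "\<mu> * (b' - b) > 0"
    using mu ab by simp
  ultimately show ?thesis by blast
qed

text \<open>To the left of \<open>\<alpha>\<close>, the profile grows because of \<open>- f\<close> for type C, and because of \<open>c\<close>, which is at least
  of order \<open>sqrt \<gamma>\<close>, for type B. For type A there is nothing to show.\<close>

lemma slow_profile_ge_left:
  assumes "\<epsilon> > 0" and "(\<forall>u. 0 < u \<and> u < \<alpha> \<longrightarrow> f u < 0) \<or> integral {0..1} f > 0"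
  shows "\<exists>m>0. \<forall>\<gamma> c y. slow_profile \<gamma> c y \<longrightarrow> (\<forall>u. \<epsilon> \<le> u \<and> u < \<alpha> \<longrightarrow> m \<le> y u)"
  using assms(2)
proof
  assume neg: "\<forall>u. 0 < u \<and> u < \<alpha> \<longrightarrow> f u < 0"
  show ?thesis
  proof (cases "\<epsilon> < \<alpha>")
    case False
    then show ?thesis by (intro exI[of _ 1]) auto
  next
    case True
    have anti: "primitive t < primitive s" if "0 \<le> s" "s < t" "t < \<alpha>" for s t
    proof (rule DERIV_neg_imp_decreasing_open[OF that(2)])
      show "\<exists>d. (primitive has_real_derivative d) (at x) \<and> d < 0" if "s < x" "x < t" for x
        using DERIV_primitive[of x] neg that \<open>0 \<le> s\<close> \<open>t < \<alpha>\<close> alpha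
        by (intro exI[of _ "extension x"]) (auto simp: extension_eq)
      show "continuous_on {s..t} primitive"
        by (intro continuous_at_imp_continuous_on ballI DERIV_isCont[OF DERIV_primitive])
    qed
    have "primitive 0 - primitive \<epsilon> \<le> y u" if slow: "slow_profile \<gamma> c y" and u: "\<epsilon> \<le> u" "u < \<alpha>" for \<gamma> c y u
    proof -
      have "primitive u \<le> primitive \<epsilon>"
        using anti[of \<epsilon> u] u assms(1) by (cases "u = \<epsilon>") auto
      moreover have "primitive 0 - primitive u \<le> y u"
        using slow u assms(1) alpha by (intro profile_ge_primitive[of \<gamma> c y]) (auto simp: slow_profile_def)
      ultimately show ?thesis by simp
    qed
    then show ?thesis
      using anti[of 0 \<epsilon>] assms(1) True by (intro exI[of _ "primitive 0 - primitive \<epsilon>"]) auto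
  qed
next
  assume int: "integral {0..1} f > 0"
  \<comment> \<open>Growth rate of \<open>sqrt y\<close> on \<open>(0, \<alpha>)\<close>: \<open>integral {0..1} f / sqrt k\<close> bounds \<open>c / sqrt \<gamma>\<close> from below.\<close>
  define B where "B = integral {0..1} f / sqrt k * sqrt 2 / (2 * (1 + k))"
  have B: "B > 0"
    using int k_pos by (simp add: B_def)
  have "(B * \<epsilon>)\<^sup>2 \<le> y u" if slow: "slow_profile \<gamma> c y" and u: "\<epsilon> \<le> u" "u < \<alpha>" for \<gamma> c y u
  proof -
    have \<gamma>: "0 < \<gamma>" "\<gamma> \<le> 1" and c: "0 \<le> c" and y: "profile f \<gamma> c y"
      using slow by (auto simp: slow_profile_def)
    have "integral {0..1} f \<le> c * sqrt (k / \<gamma>)"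
      by (rule profile_speed_lower[OF \<gamma>(1) c y])
    then have "integral {0..1} f / sqrt k \<le> c / sqrt \<gamma>"
      using k_pos \<gamma> by (simp add: real_sqrt_divide field_simps)
    then have "B \<le> c / sqrt \<gamma> * sqrt 2 / (2 * (1 + k))"
      unfolding B_def using k_pos by (intro divide_right_mono mult_right_mono) auto
    also have "\<dots> = c * sqrt (2 / \<gamma>) / (2 * (1 + k))"
      by (simp add: real_sqrt_divide)
    also have "\<dots> \<le> c * sqrt (2 / \<gamma>) / (2 * (1 + \<gamma> * (k / 2)))"
    proof (rule divide_left_mono)
      have "\<gamma> * (k / 2) \<le> 1 * k"
        using \<gamma> k_pos by (intro mult_mono) auto
      then show "2 * (1 + \<gamma> * (k / 2)) \<le> 2 * (1 + k)" by simp
    qed (use c \<gamma> k_pos in \<open>auto intro!: mult_pos_pos add_pos_nonneg\<close>)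
    also have "\<dots> = c * (sqrt (2 / \<gamma>) / (1 + \<gamma> * (k / 2))) / 2"
      by simp
    finally have "B * u \<le> c * (sqrt (2 / \<gamma>) / (1 + \<gamma> * (k / 2))) / 2 * u"
      using u assms(1) by (intro mult_right_mono) auto
    also have "\<dots> \<le> sqrt (y u)"
      by (rule sqrt_profile_ge_left[OF \<gamma>(1) c y profile_le_half[OF \<gamma>(1) c y]]) (use u assms(1) in auto)
    finally have "B * \<epsilon> \<le> sqrt (y u)"
      using mult_left_mono[OF u(1), of B] B by linarith
    then have "(B * \<epsilon>)\<^sup>2 \<le> (sqrt (y u))\<^sup>2"
      using B assms(1) by (intro power_mono) auto
    then show ?thesis
      using profile_pos[OF y, of u] u assms(1) alpha by simp
  qed
  then show ?thesis
    using B assms(1) by (intro exI[of _ "(B * \<epsilon>)\<^sup>2"]) auto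
qed

text \<open>Around \<open>\<alpha>\<close> itself neither of the preceding bounds applies, but a profile decreases at a rate of at most \<open>k\<close>.\<close>

lemma slow_profile_ge:
  assumes "0 < \<epsilon>" and cond: "(\<forall>u. 0 < u \<and> u < \<alpha> \<longrightarrow> f u < 0) \<or> integral {0..1} f > 0"
  shows "\<exists>m>0. \<forall>\<gamma> c y. slow_profile \<gamma> c y \<longrightarrow> (\<forall>u. \<epsilon> \<le> u \<and> u \<le> 1 - \<epsilon> \<longrightarrow> m \<le> y u)"
proof -
  obtain m1 where m1: "m1 > 0"
    "\<And>\<gamma> c y u. slow_profile \<gamma> c y \<Longrightarrow> \<epsilon> \<le> u \<Longrightarrow> u < \<alpha> \<Longrightarrow> m1 \<le> y u"
    using slow_profile_ge_left[OF assms] by blast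
  obtain \<eta> m2 where m2: "\<eta> > 0" "m2 > 0"
    "\<And>\<gamma> c y u. slow_profile \<gamma> c y \<Longrightarrow> \<epsilon> \<le> u \<Longrightarrow> \<alpha> \<le> u \<Longrightarrow> u < 1 \<Longrightarrow> u \<le> \<alpha> + \<eta> \<Longrightarrow> m2 \<le> y u"
  proof (cases "\<alpha> = 0")
    case True
    then show ?thesis
      using assms(1) by (intro that[of "\<epsilon> / 2" 1]) auto
  next
    case False
    then have "\<alpha> > 0"
      using alpha by simp
    then obtain m where m: "m > 0"
      "\<And>\<gamma> c y u. slow_profile \<gamma> c y \<Longrightarrow> \<alpha> / 2 \<le> u \<Longrightarrow> u < \<alpha> \<Longrightarrow> m \<le> y u"
      using slow_profile_ge_left[OF _ cond, of "\<alpha> / 2"] by auto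
    \<comment> \<open>A decrease from \<open>m\<close> to \<open>m / 2\<close> takes at least the length \<open>2 * \<eta>\<close>.\<close>
    define \<eta> where "\<eta> = m / (4 * k)"
    have \<eta>: "\<eta> > 0" "k * (2 * \<eta>) = m / 2"
      using m k_pos by (auto simp: \<eta>_def)
    show ?thesis
    proof (rule that[of \<eta> "m / 2"])
      fix \<gamma> c y u assume slow: "slow_profile \<gamma> c y" and u: "\<alpha> \<le> u" "u < 1" "u \<le> \<alpha> + \<eta>"
      define s where "s = \<alpha> - min (\<alpha> / 2) \<eta>"
      have s: "\<alpha> / 2 \<le> s" "s < \<alpha>" "\<alpha> - \<eta> \<le> s"
        using \<open>\<alpha> > 0\<close> \<eta> by (auto simp: s_def)
      have "k * (u - s) \<le> k * (2 * \<eta>)"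
        using s u k_pos by (intro mult_left_mono) auto
      moreover have "y s - k * (u - s) \<le> y u"
        using slow s u \<open>\<alpha> > 0\<close> by (intro profile_ge_shift[of \<gamma> c]) (auto simp: slow_profile_def)
      ultimately show "m / 2 \<le> y u"
        using m(2)[OF slow s(1,2)] \<eta>(2) by linarith
    qed (use \<eta> m in auto)
  qed
  obtain m3 where m3: "m3 > 0"
    "\<And>\<gamma> c y u. slow_profile \<gamma> c y \<Longrightarrow> \<alpha> + \<eta> \<le> u \<Longrightarrow> u \<le> 1 - \<epsilon> \<Longrightarrow> m3 \<le> y u"
  proof (cases "\<alpha> + \<eta> \<le> 1 - \<epsilon>")
    case True
    then show ?thesis
      using slow_profile_ge_right[of "\<alpha> + \<eta>" "1 - \<epsilon>"] m2(1) assms(1) that by auto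
  next
    case False
    then show ?thesis
      using that[of 1] by auto
  qed
  have "min m1 (min m2 m3) \<le> y u" if "slow_profile \<gamma> c y" "\<epsilon> \<le> u" "u \<le> 1 - \<epsilon>" for \<gamma> c y u
    using m1(2)[OF that(1,2)] m2(3)[OF that(1,2)] m3(2)[OF that(1) _ that(3)] that assms(1)
    by (cases "u < \<alpha>"; cases "u \<le> \<alpha> + \<eta>") auto
  then show ?thesis
    using m1(1) m2(2) m3(1) by (intro exI[of _ "min m1 (min m2 m3)"]) auto
qed

section \<open>The transition layer\<close>

text \<open>Within \<open>[\<epsilon>, 1 - \<epsilon>]\<close> the wave has speed at least \<open>slope \<gamma> m\<close>; staying there for a time \<open>\<delta>\<close> would make \<open>v\<close>
  gain \<open>1\<close>.\<close>

lemma steep_transition: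
  assumes \<gamma>: "\<gamma> > 0" and het: "heteroclinic f \<gamma> c v"
    and y: "\<And>z. 0 < v z \<Longrightarrow> v z < 1 \<Longrightarrow> deriv v z = slope \<gamma> (y (v z))"
    and m: "m \<ge> 0" "\<And>u. \<epsilon> \<le> u \<Longrightarrow> u \<le> 1 - \<epsilon> \<Longrightarrow> m \<le> y u"
    and \<epsilon>: "0 < \<epsilon>" "\<epsilon> \<le> v 0" "v 0 \<le> 1 - \<epsilon>"
    and \<delta>: "\<delta> > 0" "1 \<le> \<delta> * slope \<gamma> m"
  shows "\<delta> \<le> z \<Longrightarrow> 1 - \<epsilon> \<le> v z" "z \<le> - \<delta> \<Longrightarrow> v z \<le> \<epsilon>"
proof -
  interpret wave f k \<alpha> \<gamma> c v
    by unfold_locales (rule \<gamma> het)+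
  have steep: "slope \<gamma> m \<le> deriv v z" if "\<epsilon> \<le> v z" "v z \<le> 1 - \<epsilon>" for z
    using y[of z] slope_mono[OF \<gamma> m(1) m(2)[OF that]] that \<epsilon>(1) by simp
  have growth: "1 \<le> v t - v s" if st: "\<epsilon> \<le> v s" "v t \<le> 1 - \<epsilon>" "t - s = \<delta>" for s t
  proof -
    have "v s - slope \<gamma> m * s \<le> v t - slope \<gamma> m * t"
    proof (rule DERIV_nonneg_imp_nondecreasing[where f = "\<lambda>z. v z - slope \<gamma> m * z"])
      show "s \<le> t"
        using st \<delta> by simp
      fix x assume "s \<le> x" "x \<le> t"
      then have "v s \<le> v x" "v x \<le> v t"
        using v_mono by (auto dest: monoD)
      then have "0 \<le> deriv v x - slope \<gamma> m"
        using steep[of x] st by simp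
      moreover have "((\<lambda>z. v z - slope \<gamma> m * z) has_real_derivative deriv v x - slope \<gamma> m) (at x)"
        by (intro DERIV_diff DERIV_v DERIV_cmult_Id)
      ultimately show "\<exists>d. ((\<lambda>z. v z - slope \<gamma> m * z) has_real_derivative d) (at x) \<and> 0 \<le> d"
        by blast
    qed
    moreover have "slope \<gamma> m * t = slope \<gamma> m * s + \<delta> * slope \<gamma> m"
      using st(3) by (simp add: algebra_simps flip: distrib_left)
    ultimately show ?thesis
      using \<delta>(2) by linarith
  qed
  show "1 - \<epsilon> \<le> v z" if "\<delta> \<le> z"
  proof -
    have "1 - \<epsilon> \<le> v \<delta>"
      using growth[of 0 \<delta>] \<epsilon> by (cases "v \<delta> \<le> 1 - \<epsilon>") auto
    then show ?thesis
      using monoD[OF v_mono that] by simp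
  qed
  show "v z \<le> \<epsilon>" if "z \<le> - \<delta>"
  proof -
    have "v (- \<delta>) \<le> \<epsilon>"
      using growth[of "- \<delta>" 0] \<epsilon> v_ge_0[of "- \<delta>"] by (cases "\<epsilon> \<le> v (- \<delta>)") auto
    then show ?thesis
      using monoD[OF v_mono that] by simp
  qed
qed

lemma uniform_transition:
  fixes c :: "real \<Rightarrow> real" and v :: "real \<Rightarrow> real \<Rightarrow> real"
  assumes cond: "(\<forall>u. 0 < u \<and> u < \<alpha> \<longrightarrow> f u < 0) \<or> integral {0..1} f > 0"
    and het: "\<And>\<gamma>. \<gamma> > 0 \<Longrightarrow> heteroclinic f \<gamma> (c \<gamma>) (v \<gamma>)"
    and v0: "\<And>\<gamma>. \<gamma> > 0 \<Longrightarrow> v \<gamma> 0 = V0" "0 < V0" "V0 < 1"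
    and c: "\<And>\<gamma>. 0 < \<gamma> \<Longrightarrow> \<gamma> \<le> 1 \<Longrightarrow> c \<gamma> \<le> sqrt 2 * (k + 2) * sqrt \<gamma>"
    and "\<epsilon> > 0" "\<delta> > 0"
  shows "\<forall>\<^sub>F \<gamma> in at_right 0. \<forall>z. \<delta> \<le> \<bar>z\<bar> \<longrightarrow> \<bar>v \<gamma> z - H z\<bar> \<le> \<epsilon>"
proof -
  \<comment> \<open>With this \<open>e\<close> the initial value \<open>V0\<close> lies in \<open>[e, 1 - e]\<close>.\<close>
  define e where "e = min \<epsilon> (min V0 (1 - V0))"
  have e: "0 < e" "e \<le> V0" "V0 \<le> 1 - e" "e \<le> \<epsilon>"
    using assms by (auto simp: e_def)
  obtain m where m: "m > 0"
    "\<And>\<gamma> c y u. slow_profile \<gamma> c y \<Longrightarrow> e \<le> u \<Longrightarrow> u \<le> 1 - e \<Longrightarrow> m \<le> y u"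
    using slow_profile_ge[OF e(1) cond] by blast
  \<comment> \<open>For \<open>\<gamma> \<le> \<gamma>0\<close>, \<open>slope \<gamma> m\<close> is at least \<open>1 / \<delta>\<close>.\<close>
  define \<gamma>0 where "\<gamma>0 = min 1 (2 * m * \<delta>\<^sup>2 / (1 + m)\<^sup>2)"
  have "\<gamma>0 > 0"
    using m(1) \<open>\<delta> > 0\<close> by (simp add: \<gamma>0_def)
  have "\<bar>v \<gamma> z - H z\<bar> \<le> \<epsilon>" if \<gamma>: "0 < \<gamma>" "\<gamma> < \<gamma>0" and z: "\<delta> \<le> \<bar>z\<bar>" for \<gamma> z
  proof -
    have \<gamma>1: "\<gamma> \<le> 1" "\<gamma> \<le> 2 * m * \<delta>\<^sup>2 / (1 + m)\<^sup>2"
      using \<gamma> by (auto simp: \<gamma>0_def)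
    obtain y where y: "profile f \<gamma> (c \<gamma>) y"
      "\<And>z. 0 < v \<gamma> z \<Longrightarrow> v \<gamma> z < 1 \<Longrightarrow> deriv (v \<gamma>) z = slope \<gamma> (y (v \<gamma> z))"
      using heteroclinic_imp_profile(2)[OF \<gamma>(1) het[OF \<gamma>(1)]] by blast
    have slow: "slow_profile \<gamma> (c \<gamma>) y"
      using y(1) c[OF \<gamma>(1) \<gamma>1(1)] \<gamma> \<gamma>1 heteroclinic_imp_profile(1)[OF \<gamma>(1) het[OF \<gamma>(1)]]
      by (simp add: slow_profile_def)
    have "(1 + m)\<^sup>2 \<le> \<delta>\<^sup>2 * (2 / \<gamma> * m)"
      using \<gamma>1(2) \<gamma>(1) m(1) by (simp add: field_simps)
    then have "sqrt ((1 + m)\<^sup>2) \<le> sqrt (\<delta>\<^sup>2 * (2 / \<gamma> * m))"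
      by (rule real_sqrt_le_mono)
    then have "1 + m \<le> \<delta> * (sqrt (2 / \<gamma>) * sqrt m)"
      using m(1) \<open>\<delta> > 0\<close> unfolding real_sqrt_mult by simp
    then have "1 \<le> \<delta> * (sqrt (2 / \<gamma>) / (1 + m) * sqrt m)"
      using m(1) by (simp add: field_simps)
    also have "\<dots> \<le> \<delta> * (sqrt (2 / \<gamma>) / (1 + \<gamma> * m) * sqrt m)"
      using m(1) \<gamma> \<gamma>1 \<open>\<delta> > 0\<close>
      by (intro mult_left_mono mult_right_mono divide_left_mono)
        (auto intro!: mult_left_le_one_le mult_pos_pos add_pos_nonneg)
    also have "\<dots> \<le> \<delta> * slope \<gamma> m"
      using m(1) \<gamma> \<open>\<delta> > 0\<close> by (intro mult_left_mono slope_ge) auto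
    finally have \<delta>: "1 \<le> \<delta> * slope \<gamma> m" .
    have v: "\<delta> \<le> z \<Longrightarrow> 1 - e \<le> v \<gamma> z" "z \<le> - \<delta> \<Longrightarrow> v \<gamma> z \<le> e"
      using steep_transition[OF \<gamma>(1) het[OF \<gamma>(1)] y(2) less_imp_le[OF m(1)] m(2)[OF slow] e(1) _ _ \<open>\<delta> > 0\<close> \<delta>, of z]
        v0(1)[OF \<gamma>(1)] e by auto
    have "0 \<le> v \<gamma> z" "v \<gamma> z \<le> 1"
      using het[OF \<gamma>(1)] by (auto simp: heteroclinic_def)
    then show ?thesis
      using v z e \<open>\<delta> > 0\<close> by (cases "z > 0") (auto simp: H_def)
  qed
  then show ?thesis
    using eventually_at_right_real[OF \<open>\<gamma>0 > 0\<close>] by (auto elim!: eventually_mono)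
qed

end

section \<open>The singular limit\<close>

lemma integral_pos_if_pos_on_right:
  fixes f :: "real \<Rightarrow> real"
  assumes "continuous_on {0..1} f" "\<And>u. u \<in> {0..1} \<Longrightarrow> 0 \<le> f u"
    and "0 \<le> \<alpha>" "\<alpha> < 1" "\<And>u. \<alpha> < u \<Longrightarrow> u < 1 \<Longrightarrow> 0 < f u"
  shows "0 < integral {0..1} f"
proof -
  have "0 \<le> integral {0..1} f"
    by (rule integral_nonneg[OF integrable_continuous_interval[OF assms(1)] assms(2)])
  moreover have "integral {0..1} f \<noteq> 0"
    using integral_eq_0_iff[of 0 1 f] assms(1,2) assms(3,4) assms(5)[of "(\<alpha> + 1) / 2"] by force
  ultimately show ?thesis by simp
qed

lemma reaction_cases:
  fixes f :: "real \<Rightarrow> real"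
  assumes "continuous_on {0..1} f"
    and types: "type_A f \<and> V0 = 1 / 2 \<or> type_B f V0 \<or> type_C f V0"
    and "f 0 = 0" "f 1 = 0" "k > 0"
    and "\<And>s. s \<in> {0..1} \<Longrightarrow> \<bar>f s\<bar> \<le> k * s"
    and "\<And>s. s \<in> {0..1} \<Longrightarrow> \<bar>f s\<bar> \<le> k * (1 - s)"
  shows "\<exists>\<alpha>. reaction f k \<alpha> \<and> (\<alpha> = 0 \<and> type_A f \<or> \<alpha> > 0) \<and>
    ((\<forall>u. 0 < u \<and> u < \<alpha> \<longrightarrow> f u < 0) \<or> integral {0..1} f > 0) \<and> 0 < V0 \<and> V0 < 1"
  using types
proof (elim disjE)
  assume A: "type_A f \<and> V0 = 1 / 2"
  then have p: "0 < f u" if "0 < u" "u < 1" for u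
    using that by (auto simp: type_A_def)
  then have nn: "0 \<le> f u" if "u \<in> {0..1}" for u
    using that assms(3,4) by (cases "u = 0 \<or> u = 1") (auto intro: less_imp_le)
  have "0 < integral {0..1} f"
    by (rule integral_pos_if_pos_on_right[OF assms(1) nn, of 0]) (use p in auto)
  then have "reaction f k 0"
    by unfold_locales (use assms p in auto)
  then show ?thesis
    using A \<open>0 < integral {0..1} f\<close> by (intro exI[of _ 0]) auto
next
  assume B: "type_B f V0"
  then have V0: "0 < V0" "V0 < 1" and z: "\<And>u. 0 \<le> u \<Longrightarrow> u \<le> V0 \<Longrightarrow> f u = 0"
    and p: "\<And>u. V0 < u \<Longrightarrow> u < 1 \<Longrightarrow> 0 < f u"
    by (auto simp: type_B_def)
  have nn: "0 \<le> f u" if "u \<in> {0..1}" for u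
    using that z[of u] p[of u] assms(4) by (cases "u \<le> V0"; cases "u = 1") auto
  have "0 < integral {0..1} f"
    by (rule integral_pos_if_pos_on_right[OF assms(1) nn, of V0]) (use V0 p in auto)
  then have "reaction f k V0"
    by unfold_locales (use assms V0 z p in auto)
  then show ?thesis
    using V0 \<open>0 < integral {0..1} f\<close> by (intro exI[of _ V0]) auto
next
  assume C: "type_C f V0"
  then have V0: "0 < V0" "V0 < 1" and n: "\<And>u. 0 < u \<Longrightarrow> u < V0 \<Longrightarrow> f u < 0"
    and p: "\<And>u. V0 < u \<Longrightarrow> u < 1 \<Longrightarrow> 0 < f u" and "0 \<le> integral {0..1} f"
    by (auto simp: type_C_def)
  have "f V0 \<le> 0"
  proof (rule tendsto_upperbound)
    have "isCont f V0"
      using continuous_on_interior[OF assms(1), of V0] V0 by simp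
    then show "(f \<longlongrightarrow> f V0) (at_left V0)"
      by (simp add: isCont_def filterlim_at_split)
    show "\<forall>\<^sub>F u in at_left V0. f u \<le> 0"
      using eventually_at_left_real[OF V0(1)] by eventually_elim (use n in \<open>auto intro: less_imp_le\<close>)
  qed simp
  then have "f u \<le> 0" if "0 \<le> u" "u \<le> V0" for u
    using that n[of u] assms(3) by (cases "u = 0"; cases "u = V0") auto
  then have "reaction f k V0"
    by unfold_locales (use assms V0 p \<open>0 \<le> integral {0..1} f\<close> in auto)
  then show ?thesis
    using V0 n by (intro exI[of _ V0]) auto
qed

theorem theorem18:
  fixes f :: "real \<Rightarrow> real" and k V0 :: real and v :: "real \<Rightarrow> real \<Rightarrow> real"
  assumes "continuous_on {0..1} f"
    and "type_A f \<and> V0 = 1 / 2 \<or> type_B f V0 \<or> type_C f V0"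
    and "f 0 = 0" and "f 1 = 0"
    and "k > 0"
    and "\<And>s. s \<in> {0..1} \<Longrightarrow> \<bar>f s\<bar> \<le> k * s"
    and "\<And>s. s \<in> {0..1} \<Longrightarrow> \<bar>f s\<bar> \<le> k * (1 - s)"
    and "\<And>\<gamma>. \<gamma> > 0 \<Longrightarrow> heteroclinic f \<gamma> (critical_speed f \<gamma>) (v \<gamma>)"
    and "\<And>\<gamma>. \<gamma> > 0 \<Longrightarrow> v \<gamma> 0 = V0"
  shows "(critical_speed f \<longlongrightarrow> 0) (at_right 0)
    \<and> (\<forall>z. z \<noteq> 0 \<longrightarrow> ((\<lambda>\<gamma>. v \<gamma> z) \<longlongrightarrow> H z) (at_right 0))
    \<and> mono_on {0<..} (critical_speed f)
    \<and> critical_speed f \<in> O[at_right 0](sqrt)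
    \<and> (integral {0..1} f > 0 \<longrightarrow> critical_speed f \<in> \<Theta>[at_right 0](sqrt))
    \<and> (\<forall>I. 0 \<in> interior I \<longrightarrow> uniform_limit (- I) v H (at_right 0))"
proof -
  obtain \<alpha> where "reaction f k \<alpha>" and \<alpha>: "\<alpha> = 0 \<and> type_A f \<or> \<alpha> > 0"
    and cond: "(\<forall>u. 0 < u \<and> u < \<alpha> \<longrightarrow> f u < 0) \<or> integral {0..1} f > 0" and V0: "0 < V0" "V0 < 1"
    using reaction_cases[OF assms(1-7)] by blast
  then interpret reaction f k \<alpha> by blast
  define c where "c = critical_speed f"
  define C where "C = sqrt 2 * (k + 2)"
  note het = assms(8)[folded c_def]
  have "C > 0"
    using k_pos by (simp add: C_def)
  have c_nonneg: "c \<gamma> \<ge> 0" and c_profile: "\<exists>y. profile f \<gamma> (c \<gamma>) y" if "\<gamma> > 0" for \<gamma>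
    using heteroclinic_imp_profile[OF that het[OF that]] by auto
  have c_speed: "c \<gamma> \<in> wave_speeds f \<gamma>" if "\<gamma> > 0" for \<gamma>
    using c_nonneg[OF that] c_profile[OF that] that by (simp add: wave_speeds_iff)
  \<comment> \<open>For type A the critical speed is the least wave speed. For \<open>\<alpha> > 0\<close> any two waves can be compared, so
      that it suffices that the critical speed is some wave speed.\<close>
  have c_least: "wave_speeds f \<gamma> = {c \<gamma>..}" if "\<gamma> > 0" "\<not> \<alpha> > 0" for \<gamma>
    unfolding c_def using critical_speed_type_A[of \<gamma>] c_speed[of \<gamma>] that \<alpha> by auto
  have upper: "c \<gamma> \<le> C * sqrt \<gamma>" if "0 < \<gamma>" "\<gamma> \<le> 1" for \<gamma>
  proof (cases "\<alpha> > 0")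
    case True
    then show ?thesis
      unfolding C_def using profile_speed_upper that c_profile by blast
  next
    case False
    then have "C * sqrt \<gamma> \<in> wave_speeds f \<gamma>"
      unfolding C_def using that alpha by (intro sqrt_wave_speed) auto
    then show ?thesis
      using c_least[OF that(1) False] by simp
  qed
  have mono: "mono_on {0<..} c"
  proof (rule mono_onI)
    fix \<gamma> \<gamma>' :: real assume "\<gamma> \<in> {0<..}" "\<gamma>' \<in> {0<..}" "\<gamma> \<le> \<gamma>'"
    then have \<gamma>: "0 < \<gamma>" "0 < \<gamma>'" "\<gamma> \<le> \<gamma>'" by auto
    show "c \<gamma> \<le> c \<gamma>'"
    proof (cases "\<alpha> > 0")
      case True
      then show ?thesis
        using profile_speed_le[OF True \<gamma>(1,3) c_nonneg[OF \<gamma>(2)]] c_profile \<gamma> by blast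
    next
      case False
      then have "c \<gamma>' \<in> wave_speeds f \<gamma>"
        using wave_speeds_upward[OF _ \<gamma>(1,3) c_speed[OF \<gamma>(2)] order_refl] alpha by simp
      then show ?thesis
        using c_least[OF \<gamma>(1) False] by simp
    qed
  qed
  have ev: "\<forall>\<^sub>F \<gamma>::real in at_right 0. 0 < \<gamma> \<and> \<gamma> < 1"
    using eventually_at_right_real[OF zero_less_one] by simp
  have big_O: "c \<in> O[at_right 0](sqrt)"
    by (rule bigoI[of _ C], rule eventually_mono[OF ev]) (use upper c_nonneg in auto)
  have lim_c: "(c \<longlongrightarrow> 0) (at_right 0)"
  proof (rule tendsto_sandwich)
    show "\<forall>\<^sub>F \<gamma> in at_right 0. 0 \<le> c \<gamma>" "\<forall>\<^sub>F \<gamma> in at_right 0. c \<gamma> \<le> C * sqrt \<gamma>"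
      using ev by (auto elim!: eventually_mono simp: c_nonneg upper)
    have "((\<lambda>\<gamma>. C * sqrt \<gamma>) \<longlongrightarrow> C * sqrt 0) (at_right 0)"
      by (intro tendsto_intros)
    then show "((\<lambda>\<gamma>. C * sqrt \<gamma>) \<longlongrightarrow> 0) (at_right 0)"
      by simp
  qed simp
  have big_Theta: "c \<in> \<Theta>[at_right 0](sqrt)" if int: "integral {0..1} f > 0"
  proof (rule bigthetaI[OF big_O])
    define M where "M = integral {0..1} f / sqrt k"
    have "M > 0"
      using int k_pos by (simp add: M_def)
    have "M * sqrt \<gamma> \<le> c \<gamma>" if "0 < \<gamma>" for \<gamma>
    proof -
      have "integral {0..1} f \<le> c \<gamma> * sqrt (k / \<gamma>)"
        using c_profile[OF that] profile_speed_lower[OF that c_nonneg[OF that]] by blast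
      then show ?thesis
        using that k_pos by (simp add: M_def real_sqrt_divide field_simps)
    qed
    then show "c \<in> \<Omega>[at_right 0](sqrt)"
      by (intro landau_omega.bigI[OF \<open>M > 0\<close>] eventually_mono[OF ev]) (use c_nonneg in auto)
  qed
  have transition: "\<forall>\<^sub>F \<gamma> in at_right 0. \<forall>z. \<delta> \<le> \<bar>z\<bar> \<longrightarrow> \<bar>v \<gamma> z - H z\<bar> \<le> \<epsilon>"
    if "\<epsilon> > 0" "\<delta> > 0" for \<epsilon> \<delta>
    by (rule uniform_transition[OF cond het assms(9) V0 _ that]) (use upper in \<open>auto simp: C_def\<close>)
  have unif: "uniform_limit (- I) v H (at_right 0)" if "0 \<in> interior I" for I
  proof (rule uniform_limitI)
    fix e :: real assume "e > 0"
    obtain \<delta> where \<delta>: "\<delta> > 0" "ball 0 \<delta> \<subseteq> I"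
      using \<open>0 \<in> interior I\<close> by (auto simp: mem_interior)
    then have "\<delta> \<le> \<bar>z\<bar>" if "z \<in> - I" for z
      using that by (force simp: subset_iff)
    then show "\<forall>\<^sub>F \<gamma> in at_right 0. \<forall>z\<in>- I. dist (v \<gamma> z) (H z) < e"
      using transition[of "e / 2" \<delta>] \<delta>(1) \<open>e > 0\<close>
      by (force elim!: eventually_mono simp: dist_real_def)
  qed
  have pointwise: "((\<lambda>\<gamma>. v \<gamma> z) \<longlongrightarrow> H z) (at_right 0)" if "z \<noteq> 0" for z
    using tendsto_uniform_limitI[OF unif[of "ball 0 \<bar>z\<bar>"], of z] that by simp
  show ?thesis
    using lim_c pointwise mono big_O big_Theta unif unfolding c_def by blast
qed

end
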